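(* Every planar graph admits a $4$-local queue layout, and there is a planar graph whose local queue number is at least $3$.
   Context: Graphs are finite, simple and undirected. Given a linear ordering $\prec$ of the vertex set of a graph, two edges $uv$ and $xy$ nest if $u \prec x \prec y \prec v$ or $x \prec u \prec v \prec y$ (for the endpoints named suitably). A queue is a set of edges no two of which nest. A queue layout of $G$ consists of a linear ordering $\prec$ of $V(G)$ and a partition of $E(G)$ into queues; it is $\ell$-local if every vertex has incident edges in at most $\ell$ queues (the total number of queues being arbitrary). The local queue number of $G$ is the smallest $\ell$ such that $G$ has an $\ell$-local queue layout. *)

theory Defs
  imports "HOL-Analysis.Analysis" "HOL-Library.Disjoint_Sets"
begin

text \<open>An edge is represented by the two-element set of its endpoints.\<close>

definition simple_graph :: "'a set \<Rightarrow> 'a set set \<Rightarrow> bool" where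
  "simple_graph V E \<longleftrightarrow> finite V \<and> (\<forall>e\<in>E. e \<subseteq> V \<and> card e = 2)"

text \<open>
  A drawing without crossings: vertices are distinct points of the plane (\<^typ>\<open>complex\<close>), each
  edge is a simple arc joining its endpoints and avoiding all other vertices, and two different
  edges meet at most in a common endpoint.
\<close>

definition planar_drawing ::
  "'a set \<Rightarrow> 'a set set \<Rightarrow> ('a \<Rightarrow> complex) \<Rightarrow> ('a set \<Rightarrow> real \<Rightarrow> complex) \<Rightarrow> bool" where
  "planar_drawing V E p \<gamma> \<longleftrightarrow>
     inj_on p V \<and>
     (\<forall>e\<in>E. arc (\<gamma> e) \<and> {pathstart (\<gamma> e), pathfinish (\<gamma> e)} = p ` e \<and>
            path_image (\<gamma> e) \<inter> p ` V = p ` e) \<and>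
     (\<forall>e\<in>E. \<forall>f\<in>E. e \<noteq> f \<longrightarrow> path_image (\<gamma> e) \<inter> path_image (\<gamma> f) = p ` (e \<inter> f))"

definition planar_graph :: "'a set \<Rightarrow> 'a set set \<Rightarrow> bool" where
  "planar_graph V E \<longleftrightarrow> simple_graph V E \<and> (\<exists>p \<gamma>. planar_drawing V E p \<gamma>)"

text \<open>
  Vertex orderings are reflexive linear orders \<open>r\<close> as in \<^const>\<open>linear_order_on\<close>;
  the strict order is \<^term>\<open>r - Id\<close>.
\<close>

definition nested_inside :: "'a rel \<Rightarrow> 'a set \<Rightarrow> 'a set \<Rightarrow> bool" where
  "nested_inside r f e \<longleftrightarrow>
     (\<exists>u x y v. e = {u, v} \<and> f = {x, y} \<and>
        (u, x) \<in> r - Id \<and> (x, y) \<in> r - Id \<and> (y, v) \<in> r - Id)"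

definition nest :: "'a rel \<Rightarrow> 'a set \<Rightarrow> 'a set \<Rightarrow> bool" where
  "nest r e f \<longleftrightarrow> nested_inside r f e \<or> nested_inside r e f"

definition queue :: "'a rel \<Rightarrow> 'a set set \<Rightarrow> bool" where
  "queue r Q \<longleftrightarrow> (\<forall>e\<in>Q. \<forall>f\<in>Q. \<not> nest r e f)"

definition queue_layout :: "'a set \<Rightarrow> 'a set set \<Rightarrow> 'a rel \<Rightarrow> 'a set set set \<Rightarrow> bool" where
  "queue_layout V E r P \<longleftrightarrow> linear_order_on V r \<and> partition_on E P \<and> (\<forall>Q\<in>P. queue r Q)"

definition local_queue_layout ::
  "nat \<Rightarrow> 'a set \<Rightarrow> 'a set set \<Rightarrow> 'a rel \<Rightarrow> 'a set set set \<Rightarrow> bool" where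
  "local_queue_layout l V E r P \<longleftrightarrow>
     queue_layout V E r P \<and> (\<forall>v\<in>V. card {Q \<in> P. \<exists>e\<in>Q. v \<in> e} \<le> l)"

definition local_queue_number :: "'a set \<Rightarrow> 'a set set \<Rightarrow> nat" where
  "local_queue_number V E = (LEAST l. \<exists>r P. local_queue_layout l V E r P)"

text \<open>The minimum is attained, since one may put every edge into a queue of its own.\<close>

lemma local_queue_layout_exists:
  assumes "simple_graph V E"
  shows "\<exists>l r P. local_queue_layout l V E r P"
proof -
  obtain r where "well_order_on V r"
    using well_order_on by blast
  hence r: "linear_order_on V r"
    by (simp add: well_order_on_def)
  have V: "finite V" and E: "\<And>e. e \<in> E \<Longrightarrow> e \<subseteq> V"
    using assms by (auto simp: simple_graph_def)
  have "finite E"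
    using V E by (meson PowI finite_Pow_iff finite_subset subsetI)
  let ?P = "(\<lambda>e. {e}) ` E"
  have part: "partition_on E ?P"
    by (auto simp: partition_on_def disjoint_def)
  have anti: "antisym r" and trans: "trans r"
    using r by (auto simp: order_on_defs)
  have "\<not> nested_inside r e e" for e
    using anti trans by (auto simp: nested_inside_def doubleton_eq_iff dest: antisymD transD)
  hence queues: "\<forall>Q\<in>?P. queue r Q"
    by (auto simp: queue_def nest_def)
  have "card {Q \<in> ?P. \<exists>e\<in>Q. v \<in> e} \<le> card ?P" for v
    using \<open>finite E\<close> by (intro card_mono) auto
  thus ?thesis
    using r part queues unfolding local_queue_layout_def queue_layout_def by blast
qed

lemma local_queue_number_attained:
  assumes "simple_graph V E"
  shows "\<exists>r P. local_queue_layout (local_queue_number V E) V E r P"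
  unfolding local_queue_number_def
  using local_queue_layout_exists[OF assms] by (rule LeastI_ex)

end

theory Submission
  imports Defs
begin

text \<open>
  Upper bound: by Euler's formula every subgraph of a planar graph has at most three edges per
  vertex, so by Hall's theorem the edges can be directed with at most three leaving each vertex. The
  edges entering a fixed vertex form a star, and a star is a queue for every ordering, so each vertex
  meets its own star and at most three others.  The inequality in Euler's formula only needs
  that an edge closing a cycle creates a new face (Jordan), that an edge lies on at most two faces
  and that a face lies on at least three edges (both via Janiszewski).

  Lower bound: join an apex \<open>u\<close> to the ends of several disjoint edges \<open>vv'\<close>, and for each such edge
  \<open>uv\<close> add many pairs of adjacent common neighbours of \<open>u\<close> and \<open>v\<close>. In a 2-local layout with
  \<open>u < v < w\<close> and \<open>uv\<close>, \<open>uw\<close> in the same queue \<open>A\<close>, two of these pairs look alike, which forces a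
  common neighbour \<open>z\<close> with \<open>u < z < v\<close> and \<open>uz\<close>, \<open>zv\<close> in one queue \<open>C \<noteq> A\<close>. Hence all edges at \<open>v\<close>
  lie in \<open>A\<close> or \<open>C\<close>, the two queues at \<open>u\<close>. If \<open>v\<close>, \<open>v'\<close> and a vertex \<open>y\<close> to their right are all of
  this kind, then \<open>vv'\<close> nests inside \<open>uy\<close> if it is in \<open>A\<close>, and inside \<open>zy\<close> if it is in \<open>C\<close>,
  where \<open>z\<close> is the common neighbour found for \<open>y\<close>. If \<open>v\<close> and \<open>v'\<close> are on different sides of \<open>u\<close>, then
  \<open>vv'\<close> covers such a configuration instead.
\<close>

section \<open>Directing the edges\<close>

text \<open>Induction as by Halmos and Vaughan. If some proper nonempty subfamily \<open>J\<close>
  is tight, it is matched first and the rest avoids its union \<open>U\<close>; Hall's condition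
  passes to the rest because \<open>J\<close> uses up exactly \<open>card J\<close> elements. If
  none is tight, there is always a spare element, so any choice for one index leaves the condition
  intact.\<close>

theorem hall_marriage:
  assumes "finite I" "\<And>i. i \<in> I \<Longrightarrow> finite (A i)"
    and "\<And>J. J \<subseteq> I \<Longrightarrow> card J \<le> card (\<Union>(A ` J))"
  obtains g where "inj_on g I" "\<And>i. i \<in> I \<Longrightarrow> g i \<in> (A i :: 'b set)"
proof -
  have "\<exists>g. inj_on g I \<and> (\<forall>i\<in>I. g i \<in> A i)"
    using assms
  proof (induction "card I" arbitrary: I A rule: less_induct)
    case less
    note fin = less.prems(1) and finA = less.prems(2) and hall = less.prems(3)
    consider "I = {}" | J where "J \<subset> I" "J \<noteq> {}" "card (\<Union>(A ` J)) = card J"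
      | "I \<noteq> {}" "\<And>J. J \<subset> I \<Longrightarrow> J \<noteq> {} \<Longrightarrow> card (\<Union>(A ` J)) \<noteq> card J"
      by blast
    thus ?case
    proof cases
      case 1
      thus ?thesis by simp
    next
      case (2 J)
      define U where "U = \<Union>(A ` J)"
      have finJ: "finite J" "finite (I - J)"
        using fin 2(1) finite_subset by auto
      have finU: "finite U"
        unfolding U_def using finJ finA 2(1) by blast
      have "card J < card I"
        using psubset_card_mono[OF fin 2(1)] .
      then obtain g where g: "inj_on g J" "\<forall>i\<in>J. g i \<in> A i"
        using less.hyps[of J A] finJ finA hall 2(1) by (meson psubsetD psubset_imp_subset subset_trans)
      have "\<exists>h. inj_on h (I - J) \<and> (\<forall>i\<in>I - J. h i \<in> A i - U)"
      proof (rule less.hyps)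
        have "J \<subseteq> I" "J \<noteq> {}"
          using 2 by auto
        thus "card (I - J) < card I"
          using fin by (intro psubset_card_mono) auto
        show "finite (A i - U)" if "i \<in> I - J" for i
          using that finA by auto
        show "card K \<le> card (\<Union>i\<in>K. A i - U)" if K: "K \<subseteq> I - J" for K
        proof -
          have finK: "finite K" "K \<inter> J = {}"
            using K finJ finite_subset by auto
          have "card K + card J = card (K \<union> J)"
            using finK finJ by (simp add: card_Un_disjoint)
          also have "\<dots> \<le> card (\<Union>(A ` (K \<union> J)))"
            using K 2(1) by (intro hall) auto
          also have "\<Union>(A ` (K \<union> J)) = (\<Union>i\<in>K. A i - U) \<union> U"
            by (auto simp: U_def)
          also have "card \<dots> \<le> card (\<Union>i\<in>K. A i - U) + card U"
            by (rule card_Un_le)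
          finally show ?thesis
            using 2(3) by (simp add: U_def)
        qed
      qed (use finJ in auto)
      then obtain h where h: "inj_on h (I - J)" "\<forall>i\<in>I - J. h i \<in> A i - U"
        by blast
      define k where "k i = (if i \<in> J then g i else h i)" for i
      have gU: "g i \<in> U" if "i \<in> J" for i
        using g(2) that unfolding U_def by blast
      have "inj_on k I"
      proof (rule inj_onI)
        fix x y assume xy: "x \<in> I" "y \<in> I" "k x = k y"
        consider "x \<in> J" "y \<in> J" | "x \<in> J" "y \<in> I - J" | "x \<in> I - J" "y \<in> J"
          | "x \<in> I - J" "y \<in> I - J"
          using xy by blast
        thus "x = y"
        proof cases
          case 1
          thus ?thesis
            using inj_onD[OF g(1)] xy(3) by (simp add: k_def)
        next
          case 2
          thus ?thesis
            using gU[of x] bspec[OF h(2), of y] xy(3) by (simp add: k_def)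
        next
          case 3
          thus ?thesis
            using gU[of y] bspec[OF h(2), of x] xy(3) by (simp add: k_def)
        next
          case 4
          thus ?thesis
            using inj_onD[OF h(1), of x y] xy(3) by (simp add: k_def)
        qed
      qed
      moreover have "\<forall>i\<in>I. k i \<in> A i"
        using g(2) h(2) unfolding k_def by simp
      ultimately show ?thesis
        by blast
    next
      case 3
      then obtain i where i: "i \<in> I"
        by blast
      have "A i \<noteq> {}"
        using hall[of "{i}"] i by auto
      then obtain a where a: "a \<in> A i"
        by blast
      have "\<exists>h. inj_on h (I - {i}) \<and> (\<forall>j\<in>I - {i}. h j \<in> A j - {a})"
      proof (rule less.hyps)
        show "card (I - {i}) < card I"
          using card_Diff1_less[OF fin i] .
        show "finite (A j - {a})" if "j \<in> I - {i}" for j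
          using that finA by auto
        show "card K \<le> card (\<Union>j\<in>K. A j - {a})" if K: "K \<subseteq> I - {i}" for K
        proof (cases "K = {}")
          case False
          have "K \<subset> I"
            using K i by blast
          hence "card K < card (\<Union>(A ` K))"
            using 3(2)[of K] False hall[of K] by fastforce
          moreover have "(\<Union>j\<in>K. A j - {a}) = \<Union>(A ` K) - {a}"
            by auto
          moreover have "card (\<Union>(A ` K)) - 1 \<le> card (\<Union>(A ` K) - {a})"
            using card_Diff1_le diff_card_le_card_Diff[of "{a}" "\<Union>(A ` K)"] by simp
          ultimately show ?thesis
            by simp
        qed simp
      qed (use fin in auto)
      then obtain h where h: "inj_on h (I - {i})" "\<forall>j\<in>I - {i}. h j \<in> A j - {a}"
        by blast
      have "inj_on (h(i := a)) I"
        using h(1) bspec[OF h(2)] by (fastforce simp: inj_on_def)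
      moreover have "\<forall>j\<in>I. (h(i := a)) j \<in> A j"
        using h(2) a by auto
      ultimately show ?thesis
        by blast
    qed
  qed
  thus ?thesis
    using that by blast
qed

text \<open>Each vertex offers \<open>k\<close> numbered slots, and Hall's theorem gives distinct
  slots to the edges; the counting hypothesis is Hall's condition for these slots.\<close>

lemma bounded_tails:
  assumes "finite E" "\<And>e. e \<in> E \<Longrightarrow> finite e"
    and "\<And>F. F \<subseteq> E \<Longrightarrow> card F \<le> k * card (\<Union>F)"
  obtains t where "\<And>e. e \<in> E \<Longrightarrow> t e \<in> e" "\<And>v. card {e \<in> E. t e = v} \<le> k"
proof -
  have un: "(\<Union>e\<in>F. e \<times> {..<k}) = \<Union>F \<times> {..<k}" for F :: "'a set set"
    by auto
  obtain g where g: "inj_on g E" "\<And>e. e \<in> E \<Longrightarrow> g e \<in> e \<times> {..<k}"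
    by (rule hall_marriage[of E "\<lambda>e. e \<times> {..<k}"])
      (use assms in \<open>auto simp: un card_cartesian_product mult.commute\<close>)
  show ?thesis
  proof (rule that[of "fst \<circ> g"])
    show "(fst \<circ> g) e \<in> e" if "e \<in> E" for e
      using g(2)[OF that] by auto
    show "card {e \<in> E. (fst \<circ> g) e = v} \<le> k" for v
    proof -
      have "inj_on (snd \<circ> g) {e \<in> E. (fst \<circ> g) e = v}"
        using g(1) by (auto simp: inj_on_def prod_eq_iff)
      moreover have "(snd \<circ> g) ` {e \<in> E. (fst \<circ> g) e = v} \<subseteq> {..<k}"
        using g(2) by fastforce
      ultimately show ?thesis
        using card_inj_on_le[of "snd \<circ> g" _ "{..<k}"] by simp
    qed
  qed
qed

section \<open>Layouts whose queues are stars\<close>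

lemma star_queue:
  assumes r: "linear_order_on V r" and "\<And>e. e \<in> Q \<Longrightarrow> v \<in> e"
  shows "queue r Q"
proof -
  have "antisym r" "trans r"
    using r by (auto simp: order_on_defs)
  hence "\<not> nested_inside r f e" if "v \<in> e" "v \<in> f" for e f
    using that by (auto simp: nested_inside_def dest: antisymD transD)
  thus ?thesis
    using assms(2) by (auto simp: queue_def nest_def)
qed

lemma tails_imp_local_queue_layout:
  assumes G: "simple_graph V E"
    and t: "\<And>e. e \<in> E \<Longrightarrow> t e \<in> e" "\<And>v. card {e \<in> E. t e = v} \<le> k"
  shows "\<exists>r P. local_queue_layout (Suc k) V E r P"
proof -
  obtain r where "well_order_on V r"
    using well_order_on by blast
  hence r: "linear_order_on V r"
    by (simp add: well_order_on_def)
  have "finite (Pow V)" "E \<subseteq> Pow V"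
    using G by (auto simp: simple_graph_def)
  hence finE: "finite E"
    using finite_subset by blast
  have "\<exists>w. e = {t e, w}" if "e \<in> E" for e
    using that t(1)[OF that] G by (auto simp: simple_graph_def card_2_iff)
  then obtain h where h: "\<And>e. e \<in> E \<Longrightarrow> e = {t e, h e}"
    by metis
  define S where "S v = {e \<in> E. h e = v}" for v
  let ?P = "S ` h ` E"
  have "partition_on E ?P"
    by (auto simp: partition_on_def disjoint_def S_def)
  moreover have "queue r (S v)" for v
    by (rule star_queue[OF r, of _ v]) (use h in \<open>auto simp: S_def\<close>)
  moreover have "card {Q \<in> ?P. \<exists>e\<in>Q. v \<in> e} \<le> Suc k" for v
  proof -
    let ?T = "{e \<in> E. t e = v}"
    \<comment> \<open>An edge at \<open>v\<close> has head \<open>v\<close> or tail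
      \<open>v\<close>, and the latter edges contribute at most \<open>k\<close> stars.\<close>
    have "{Q \<in> ?P. \<exists>e\<in>Q. v \<in> e} \<subseteq> insert (S v) ((S \<circ> h) ` ?T)"
    proof
      fix Q assume "Q \<in> {Q \<in> ?P. \<exists>e\<in>Q. v \<in> e}"
      then obtain w e where "Q = S w" "e \<in> E" "h e = w" "v \<in> e"
        by (auto simp: S_def)
      moreover have "v = t e \<or> v = h e"
        using h[OF \<open>e \<in> E\<close>] \<open>v \<in> e\<close> by blast
      ultimately show "Q \<in> insert (S v) ((S \<circ> h) ` ?T)"
        by auto
    qed
    hence "card {Q \<in> ?P. \<exists>e\<in>Q. v \<in> e} \<le> card (insert (S v) ((S \<circ> h) ` ?T))"
      using finE by (intro card_mono) auto
    also have "\<dots> \<le> Suc (card ((S \<circ> h) ` ?T))"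
      by (rule card_insert_le_m1) simp_all
    also have "\<dots> \<le> Suc k"
      using card_image_le[of ?T "S \<circ> h"] t(2)[of v] finE by simp
    finally show ?thesis .
  qed
  ultimately show ?thesis
    using r unfolding local_queue_layout_def queue_layout_def by blast
qed

section \<open>Edges and faces of a plane drawing\<close>

text \<open>Components of the open complement are open, so a limit point of \<open>f\<close> off
  \<open>K\<close> has a component that meets \<open>f\<close> and hence equals it.\<close>

lemma closure_component_subset:
  fixes K :: "'a::real_normed_vector set"
  assumes "closed K" "f \<in> components (- K)"
  shows "closure f \<subseteq> f \<union> K"
proof
  fix x assume x: "x \<in> closure f"
  show "x \<in> f \<union> K"
  proof (rule ccontr)
    assume n: "x \<notin> f \<union> K"
    let ?g = "connected_component_set (- K) x"
    have g: "?g \<in> components (- K)"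
      using n by (auto simp: components_def)
    have "open ?g"
      using assms(1) by (simp add: open_Compl open_connected_component)
    moreover have "x \<in> ?g"
      using n by auto
    ultimately have "?g \<inter> f \<noteq> {}"
      using x by (meson disjoint_iff open_Int_closure_eq_empty)
    hence "?g = f"
      using g assms(2) by (meson components_nonoverlap)
    thus False
      using n \<open>x \<in> ?g\<close> by simp
  qed
qed

locale drawing =
  fixes V :: "'a set" and E :: "'a set set" and p :: "'a \<Rightarrow> complex"
    and \<gamma> :: "'a set \<Rightarrow> real \<Rightarrow> complex"
  assumes graph: "simple_graph V E" and drawn: "planar_drawing V E p \<gamma>"
begin

text \<open>All vertices are kept for every edge set \<open>F\<close>, so that adding an edge
  \<open>e\<close> adds only the open arc \<open>inner e\<close>.\<close>

definition K :: "'a set set \<Rightarrow> complex set" where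
  "K F = p ` V \<union> (\<Union>e\<in>F. path_image (\<gamma> e))"

definition inner :: "'a set \<Rightarrow> complex set" where
  "inner e = path_image (\<gamma> e) - p ` e"

text \<open>Incidence of a face with an edge: a single limit point on the open arc counts, the end
  points of \<open>e\<close> do not.\<close>

definition touches :: "complex set \<Rightarrow> 'a set \<Rightarrow> bool" where
  "touches f e \<longleftrightarrow> closure f \<inter> inner e \<noteq> {}"

lemma finite_V: "finite V"
  using graph by (simp add: simple_graph_def)

lemma edge: "e \<in> E \<Longrightarrow> e \<subseteq> V" "e \<in> E \<Longrightarrow> card e = 2"
  using graph by (auto simp: simple_graph_def)

lemma finite_E: "finite E"
  by (rule finite_subset[of _ "Pow V"]) (use edge finite_V in auto)

lemma inj_p: "inj_on p V"
  and arc: "e \<in> E \<Longrightarrow> arc (\<gamma> e)"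
  and ends: "e \<in> E \<Longrightarrow> {pathstart (\<gamma> e), pathfinish (\<gamma> e)} = p ` e"
  and avoid: "e \<in> E \<Longrightarrow> path_image (\<gamma> e) \<inter> p ` V = p ` e"
  and cross: "\<lbrakk>e \<in> E; f \<in> E; e \<noteq> f\<rbrakk> \<Longrightarrow> path_image (\<gamma> e) \<inter> path_image (\<gamma> f) = p ` (e \<inter> f)"
  using drawn unfolding planar_drawing_def by blast+

lemma compact_K:
  assumes "F \<subseteq> E"
  shows "compact (K F)"
  unfolding K_def
proof (intro compact_Un compact_UN)
  show "compact (p ` V)"
    using finite_V by (simp add: finite_imp_compact)
  show "finite F"
    using assms finite_E finite_subset by blast
  show "compact (path_image (\<gamma> e))" if "e \<in> F" for e
    using that assms arc compact_arc_image by blast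
qed

lemma closed_K: "F \<subseteq> E \<Longrightarrow> closed (K F)"
  by (simp add: compact_K compact_imp_closed)

lemma K_mono: "F \<subseteq> G \<Longrightarrow> K F \<subseteq> K G"
  by (auto simp: K_def)

lemma K_insert: "K (insert e F) = path_image (\<gamma> e) \<union> K F"
  by (auto simp: K_def)

lemma arc_Int_K:
  assumes "e \<in> E" "F \<subseteq> E" "e \<notin> F"
  shows "path_image (\<gamma> e) \<inter> K F = p ` e"
proof -
  have "path_image (\<gamma> e) \<inter> path_image (\<gamma> f) \<subseteq> p ` e" if "f \<in> F" for f
    using cross[of e f] that assms by auto
  thus ?thesis
    using avoid[OF assms(1)] by (auto simp: K_def)
qed

lemma inner_disjoint_K: "\<lbrakk>e \<in> E; F \<subseteq> E; e \<notin> F\<rbrakk> \<Longrightarrow> inner e \<inter> K F = {}"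
  using arc_Int_K[of e F] unfolding inner_def by blast

lemma inner_endless: "e \<in> E \<Longrightarrow> inner e = path_image (\<gamma> e) - {pathstart (\<gamma> e), pathfinish (\<gamma> e)}"
  by (simp add: inner_def ends)

lemma connected_inner: "e \<in> E \<Longrightarrow> connected (inner e)"
  by (simp add: inner_endless connected_simple_path_endless arc arc_imp_simple_path)

lemma inner_nonempty: "e \<in> E \<Longrightarrow> inner e \<noteq> {}"
  using nonempty_simple_path_endless[OF arc_imp_simple_path[OF arc]] by (simp add: inner_endless del: Diff_eq_empty_iff)

lemma K_eq: "F \<subseteq> E \<Longrightarrow> K F = p ` V \<union> (\<Union>e\<in>F. inner e)"
proof -
  assume "F \<subseteq> E"
  hence "p ` e \<subseteq> p ` V" if "e \<in> F" for e
    using that edge(1) by blast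
  thus ?thesis
    unfolding K_def inner_def by blast
qed

section \<open>Cycles and the number of faces\<close>

lemma edge_cycle:
  assumes e: "e \<in> E" "F \<subseteq> E" "e \<notin> F" and ab: "e = {a, b}" "path_component (K F) (p a) (p b)"
  obtains P c where "connected P" "P \<subseteq> K F" "p a \<in> P" "p b \<in> P"
    "simple_path c" "pathfinish c = pathstart c" "path_image c = P \<union> path_image (\<gamma> e)"
    "P \<inter> path_image (\<gamma> e) = {p a, p b}"
proof -
  have "a \<noteq> b" "a \<in> V" "b \<in> V"
    using edge[OF e(1)] ab(1) by auto
  hence ne: "p a \<noteq> p b"
    using inj_p by (metis inj_onD)
  define s t where "s = pathstart (\<gamma> e)" "t = pathfinish (\<gamma> e)"
  have st: "{s, t} = {p a, p b}"
    using ends[OF e(1)] ab(1) by (simp add: s_t_def)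
  \<comment> \<open>The arc found in \<open>K F\<close> runs from the finish of
    \<open>\<gamma> e\<close> back to its start, so that the join is a closed curve.\<close>
  hence "path_component (K F) t s"
    using ab(2) by (auto simp: doubleton_eq_iff path_component_sym)
  then obtain g0 where "path g0" "path_image g0 \<subseteq> K F" "pathstart g0 = t" "pathfinish g0 = s"
    by (auto simp: path_component_def)
  moreover have "s \<noteq> t"
    using st ne by (auto simp: doubleton_eq_iff)
  ultimately obtain g where g: "arc g" "path_image g \<subseteq> K F" "pathstart g = t" "pathfinish g = s"
    by (metis path_contains_arc order_trans)
  have int: "path_image g \<inter> path_image (\<gamma> e) = {p a, p b}"
  proof -
    have "path_image g \<inter> path_image (\<gamma> e) \<subseteq> {p a, p b}"
      using g(2) arc_Int_K[OF e] ab(1) by auto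
    moreover have "{t, s} \<subseteq> path_image g \<inter> path_image (\<gamma> e)"
      using g(3,4) by (metis Int_iff insert_subset empty_subsetI pathfinish_in_path_image pathstart_in_path_image s_t_def)
    ultimately show ?thesis
      using st by auto
  qed
  show ?thesis
  proof (rule that[of "path_image g" "g +++ \<gamma> e"])
    show "simple_path (g +++ \<gamma> e)"
      by (rule simple_path_join_loop) (use g arc[OF e(1)] int st s_t_def in auto)
  qed (use g int s_t_def in \<open>auto simp: path_image_join connected_arc_image\<close>)
qed

text \<open>Every point of a Jordan curve lies on the frontier of its inside and of its outside. A
  small ball around a point of \<open>inner e\<close> avoids \<open>K F\<close> and contains a point
  on each side; both are joined to \<open>inner e\<close> within \<open>- K F\<close>, but the curve
  separates them once \<open>e\<close> is drawn.\<close>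

lemma cycle_edge_splits:
  assumes e: "e \<in> E" "F \<subseteq> E" "e \<notin> F" and ab: "e = {a, b}" "path_component (K F) (p a) (p b)"
  obtains y z where "y \<notin> K (insert e F)" "z \<notin> K (insert e F)"
    "\<And>x. x \<in> inner e \<Longrightarrow> connected_component (- K F) x y"
    "\<And>x. x \<in> inner e \<Longrightarrow> connected_component (- K F) x z"
    "\<not> connected_component (- K (insert e F)) y z"
proof -
  obtain P c where P: "P \<subseteq> K F" and c: "simple_path c" "pathfinish c = pathstart c"
    "path_image c = P \<union> path_image (\<gamma> e)"
    using edge_cycle[OF assms] by metis
  let ?J = "path_image c"
  have J: "frontier (inside ?J) = ?J" "frontier (outside ?J) = ?J"
    using Jordan_inside_outside[OF c(1,2)] by auto
  obtain x where x: "x \<in> inner e"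
    using inner_nonempty[OF e(1)] by blast
  have xK: "x \<in> - K F" "x \<in> ?J"
    using x inner_disjoint_K[OF e] c(3) by (auto simp: inner_def)
  then obtain r where r: "r > 0" "ball x r \<subseteq> - K F"
    using closed_K[OF e(2)] by (meson open_Compl open_contains_ball)
  have "x \<in> closure (inside ?J)" "x \<in> closure (outside ?J)"
    using J xK(2) by (auto simp: frontier_def)
  then obtain y z where yz: "y \<in> inside ?J" "y \<in> ball x r" "z \<in> outside ?J" "z \<in> ball x r"
    using r(1) by (metis closure_approachable mem_ball dist_commute)
  have sub: "?J \<subseteq> K (insert e F)"
    using c(3) P by (auto simp: K_insert)
  show ?thesis
  proof (rule that[of y z])
    show "y \<notin> K (insert e F)" "z \<notin> K (insert e F)"
      using yz r(2) inside_no_overlap[of ?J] outside_no_overlap[of ?J]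
      unfolding K_insert c(3) by blast+
    have "connected (ball x r \<union> inner e)"
    proof (rule connected_Un)
      show "ball x r \<inter> inner e \<noteq> {}"
        using x r(1) centre_in_ball by blast
    qed (use connected_inner[OF e(1)] in auto)
    moreover have "ball x r \<union> inner e \<subseteq> - K F"
      using r(2) inner_disjoint_K[OF e] by auto
    ultimately show "connected_component (- K F) x' y" "connected_component (- K F) x' z"
      if "x' \<in> inner e" for x'
      using yz that unfolding connected_component_def by (meson UnCI)+
    show "\<not> connected_component (- K (insert e F)) y z"
    proof
      assume "connected_component (- K (insert e F)) y z"
      hence "connected_component (- ?J) y z"
        by (rule connected_component_of_subset) (use sub in auto)
      hence "z \<in> inside ?J"
        using yz(1) inside_same_component by blast
      thus False
        using yz(3) inside_Int_outside by blast
    qed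
  qed
qed

text \<open>The face \<open>C\<close> that contains \<open>inner e\<close> breaks up, with
  \<open>Y\<close> and \<open>Z\<close> among its pieces, and the other faces survive. Counting with
  a finite set \<open>R\<close> of faces gives lower bounds without presupposing that there are
  finitely many faces.\<close>

lemma more_components:
  assumes e: "e \<in> E" "F \<subseteq> E" "e \<notin> F" and ab: "e = {a, b}" "path_component (K F) (p a) (p b)"
    and R: "finite R" "R \<subseteq> components (- K F)"
  obtains R' where "finite R'" "R' \<subseteq> components (- K (insert e F))" "card R < card R'"
proof -
  obtain y z where yz: "y \<notin> K (insert e F)" "z \<notin> K (insert e F)"
    "\<And>x. x \<in> inner e \<Longrightarrow> connected_component (- K F) x y"
    "\<And>x. x \<in> inner e \<Longrightarrow> connected_component (- K F) x z"
    "\<not> connected_component (- K (insert e F)) y z"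
    using cycle_edge_splits[OF e ab] by metis
  define C where "C = connected_component_set (- K F) y"
  define Y where "Y = connected_component_set (- K (insert e F)) y"
  define Z where "Z = connected_component_set (- K (insert e F)) z"
  have sub: "- K (insert e F) \<subseteq> - K F"
    using K_mono by blast
  obtain x where "x \<in> inner e"
    using inner_nonempty[OF e(1)] by blast
  hence "connected_component (- K F) y z"
    using yz(3,4) by (meson connected_component_sym connected_component_trans)
  hence Cz: "C = connected_component_set (- K F) z"
    using connected_component_eq[of z "- K F" y] by (simp add: C_def)
  have inner: "inner e \<subseteq> C"
    using yz(3) by (auto simp: C_def intro: connected_component_sym)
  have YZ: "Y \<subseteq> C" "Z \<subseteq> C" "y \<in> Y" "z \<in> Z" "Y \<in> components (- K (insert e F))"
    "Z \<in> components (- K (insert e F))"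
    using yz(1,2) connected_component_mono[OF sub] Cz by (auto simp: Y_def Z_def C_def components_def)
  have "Y \<noteq> Z"
    using yz(5) YZ(3,4) by (auto simp: Y_def)
  have old: "D \<in> components (- K (insert e F))" if D: "D \<in> R - {C}" for D
  proof -
    have DK: "D \<in> components (- K F)" "D \<noteq> C"
      using D R by auto
    moreover have "C \<in> components (- K F)"
      using yz(1) sub by (auto simp: C_def components_def)
    ultimately have "D \<inter> C = {}"
      by (meson components_nonoverlap)
    hence "D \<subseteq> - K (insert e F)"
      using inner in_components_subset[OF DK(1)] arc_Int_K[OF e]
      by (fastforce simp: K_insert inner_def)
    thus ?thesis
      using DK(1) sub by (meson components_intermediate_subset)
  qed
  have disj: "Y \<notin> R - {C}" "Z \<notin> R - {C}"
  proof -
    have "C \<in> components (- K F)"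
      using yz(1) sub by (auto simp: C_def components_def)
    hence "D \<inter> C = {}" if "D \<in> R - {C}" for D
      using that R(2) by (metis DiffD1 DiffD2 components_nonoverlap singletonI subsetD)
    thus "Y \<notin> R - {C}" "Z \<notin> R - {C}"
      using YZ by blast+
  qed
  \<comment> \<open>The gain is one face if \<open>C\<close> is in \<open>R\<close> and two
    otherwise.\<close>
  have "card R < card (insert Y (insert Z (R - {C})))"
    using disj \<open>Y \<noteq> Z\<close> R(1) by (cases "C \<in> R") (auto simp: card_Diff_singleton card_gt_0_iff)
  moreover have "insert Y (insert Z (R - {C})) \<subseteq> components (- K (insert e F))"
    using old YZ by auto
  moreover have "finite (insert Y (insert Z (R - {C})))"
    using R(1) by simp
  ultimately show ?thesis
    using that by blast
qed

text \<open>
  \<open>T\<close> is a spanning forest and \<open>c\<close> labels the vertices by its components.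
\<close>

lemma spanning_forest:
  assumes "F \<subseteq> E"
  shows "\<exists>T c. T \<subseteq> F \<and> card T + card (c ` V) \<le> card V \<and> 
    (\<forall>x\<in>V. \<forall>y\<in>V. c x = c y \<longrightarrow> path_component (K T) (p x) (p y)) \<and>
    (\<forall>e\<in>F. \<exists>a b. e = {a, b} \<and> c a = (c b :: 'a))"
proof -
  have "finite F"
    using assms finite_E finite_subset by blast
  thus ?thesis
    using assms
  proof (induction F rule: finite_induct)
    case empty
    have "\<forall>x\<in>V. path_component (K {}) (p x) (p x)"
      by (auto simp: K_def path_component_refl_eq)
    thus ?case
      by (intro exI[of _ "{}"] exI[of _ "\<lambda>x. x"]) auto
  next
    case (insert e F)
    then obtain T and c :: "'a \<Rightarrow> 'a" where T: "T \<subseteq> F" "card T + card (c ` V) \<le> card V"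
      "\<And>x y. x \<in> V \<Longrightarrow> y \<in> V \<Longrightarrow> c x = c y \<Longrightarrow> path_component (K T) (p x) (p y)"
      "\<And>e. e \<in> F \<Longrightarrow> \<exists>a b. e = {a, b} \<and> c a = c b"
      by auto
    have e: "e \<in> E"
      using insert by auto
    obtain a b where ab: "e = {a, b}" "a \<in> V" "b \<in> V"
      using edge[OF e] by (auto simp: card_2_iff)
    show ?case
    proof (cases "c a = c b")
      case True
      show ?thesis
        by (rule exI[of _ T], rule exI[of _ c]) (use T ab True in auto)
    next
      case False
      \<comment> \<open>The new forest edge \<open>e\<close> merges the class of \<open>b\<close>
        into that of \<open>a\<close>; the label that disappears pays for the edge.\<close>
      define d where "d x = (if c x = c b then c a else c x)" for x
      have "d ` V \<subseteq> c ` V - {c b}"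
        using False ab by (auto simp: d_def)
      hence "card (d ` V) \<le> card (c ` V - {c b})"
        using finite_V by (intro card_mono) auto
      also have "\<dots> = card (c ` V) - 1"
        using ab by (intro card_Diff_singleton) auto
      finally have cd: "card (d ` V) + 1 \<le> card (c ` V)"
        using ab finite_V card_gt_0_iff[of "c ` V"] by fastforce
      have finT: "finite T" "e \<notin> T"
        using T(1) insert finite_subset by blast+
      have mono: "path_component (K (insert e T)) (p x) (p y)"
        if "x \<in> V" "y \<in> V" "c x = c y" for x y
        using T(3)[OF that] path_component_of_subset[OF K_mono] by (metis subset_insertI)
      have "path_component (path_image (\<gamma> e)) (pathstart (\<gamma> e)) (pathfinish (\<gamma> e))"
        using arc[OF e] by (metis arc_imp_path path_component_def subset_refl)
      hence "path_component (path_image (\<gamma> e)) (p a) (p b)"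
        using ends[OF e] ab(1) path_component_sym by (auto simp: doubleton_eq_iff)
      hence pab: "path_component (K (insert e T)) (p a) (p b)"
        by (rule path_component_of_subset[rotated]) (auto simp: K_insert)
      have pc: "path_component (K (insert e T)) (p x) (p y)" if "x \<in> V" "y \<in> V" "d x = d y" for x y
      proof -
        have "c x = c y \<or> c x = c b \<and> c y = c a \<or> c x = c a \<and> c y = c b"
          using that(3) by (cases "c x = c b"; cases "c y = c b") (simp_all add: d_def)
        then consider "c x = c y" | "c x = c b" "c y = c a" | "c x = c a" "c y = c b"
          by blast
        thus ?thesis
        proof cases
          case 1 thus ?thesis using mono that by blast
        next
          case 2 thus ?thesis using mono[of x b] mono[of a y] pab that ab
            by (metis path_component_sym path_component_trans)
        next
          case 3 thus ?thesis using mono[of x a] mono[of b y] pab that ab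
            by (metis path_component_trans)
        qed
      qed
      have "\<exists>a b. f = {a, b} \<and> d a = d b" if f: "f \<in> insert e F" for f
      proof (cases "f = e")
        case True thus ?thesis using ab by (intro exI[of _ a] exI[of _ b]) (auto simp: d_def)
      next
        case False 
        then obtain a' b' where "f = {a', b'}" "c a' = c b'" using T(4) f by blast
        thus ?thesis by (intro exI[of _ a'] exI[of _ b']) (auto simp: d_def)
      qed
      moreover have "card (insert e T) + card (d ` V) \<le> card V"
        using T(2) cd finT by simp
      ultimately show ?thesis
        using pc T(1) by (intro exI[of _ "insert e T"] exI[of _ d]) auto
    qed
  qed
qed

text \<open>Euler's inequality: the forest has at most \<open>card V - 1\<close> edges and leaves at
  least one face, and each further edge joins vertices already connected by it, hence adds a
  face.\<close>

lemma many_components: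
  assumes "V \<noteq> {}"
  obtains R where "finite R" "R \<subseteq> components (- K E)" "card E + 2 \<le> card R + card V"
proof -
  obtain T and c :: "'a \<Rightarrow> 'a" where T: "T \<subseteq> E" "card T + card (c ` V) \<le> card V"
      "\<forall>x\<in>V. \<forall>y\<in>V. c x = c y \<longrightarrow> path_component (K T) (p x) (p y)"
      "\<forall>e\<in>E. \<exists>a b. e = {a, b} \<and> c a = c b"
    using spanning_forest[OF order_refl] by (elim exE conjE) (rule that; assumption)
  have "card (c ` V) > 0"
    using assms finite_V by (simp add: card_gt_0_iff)
  hence cT: "card T + 1 \<le> card V"
    using T(2) by simp
  have *: "\<exists>R. finite R \<and> R \<subseteq> components (- K (T \<union> G)) \<and> card G + 1 \<le> card R"
    if "finite G" "G \<subseteq> E - T" for G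
    using that
  proof (induction G rule: finite_induct)
    case empty
    have "K T \<noteq> UNIV"
      using compact_imp_bounded[OF compact_K[OF T(1)]] not_bounded_UNIV by auto
    hence "- K T \<noteq> {}"
      by auto
    then obtain C where "C \<in> components (- K T)"
      using components_eq_empty by blast
    thus ?case
      by (intro exI[of _ "{C}"]) auto
  next
    case (insert e G)
    then obtain R where R: "finite R" "R \<subseteq> components (- K (T \<union> G))" "card G + 1 \<le> card R"
      by blast
    obtain a b where ab: "e = {a, b}" "c a = c b"
      using T(4) insert.prems by blast
    have e: "e \<in> E" "T \<union> G \<subseteq> E" "e \<notin> T \<union> G"
      using insert T by auto
    have "a \<in> V" "b \<in> V"
      using ab edge[OF e(1)] by auto
    hence "path_component (K (T \<union> G)) (p a) (p b)"
      using T(3) ab(2) path_component_of_subset[OF K_mono] by (metis Un_upper1)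
    from more_components[OF e ab(1) this R(1,2)] obtain R' where
      "finite R'" "R' \<subseteq> components (- K (insert e (T \<union> G)))" "card R < card R'" .
    thus ?case
      using R(3) insert.hyps by (intro exI[of _ R']) auto
  qed
  obtain R where "finite R" "R \<subseteq> components (- K (T \<union> (E - T)))" "card (E - T) + 1 \<le> card R"
    using *[of "E - T"] finite_E by blast
  moreover have "T \<union> (E - T) = E" "card (E - T) = card E - card T" "card T \<le> card E"
    using T(1) finite_E by (auto simp: card_Diff_subset finite_subset card_mono)
  ultimately show ?thesis
    using that[of R] cT by auto
qed

section \<open>Incidences between edges and faces\<close>

lemma connected_Compl_two_arcs:
  assumes "e \<in> E" "f \<in> E"
  shows "connected (- (path_image (\<gamma> e) \<union> path_image (\<gamma> f)))"
proof (cases "e = f")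
  case True
  thus ?thesis
    using connected_arc_complement[OF arc[OF assms(1)]] by simp
next
  case False
  \<comment> \<open>Distinct edges share at most one vertex, so the two arcs meet in a connected
    set, as Janiszewski's theorem requires.\<close>
  have "\<exists>x. e \<inter> f \<subseteq> {x}"
  proof (rule ccontr)
    assume "\<nexists>x. e \<inter> f \<subseteq> {x}"
    hence "e \<inter> f \<noteq> {}" by blast
    then obtain x where "x \<in> e \<inter> f" by blast
    moreover obtain y where "y \<in> e \<inter> f" "y \<noteq> x"
      using \<open>\<nexists>x. e \<inter> f \<subseteq> {x}\<close> by blast
    ultimately have "e = {x, y}" "f = {x, y}"
      using edge(2)[OF assms(1)] edge(2)[OF assms(2)] by (auto simp: card_2_iff)
    thus False using False by simp
  qed
  then obtain x where "p ` (e \<inter> f) \<subseteq> {p x}"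
    by blast
  hence int: "connected (path_image (\<gamma> e) \<inter> path_image (\<gamma> f))"
    using cross[OF assms False] by (metis connected_empty connected_sing subset_singletonD)
  have "connected_component (- (path_image (\<gamma> e) \<union> path_image (\<gamma> f))) a b"
    if "a \<in> - (path_image (\<gamma> e) \<union> path_image (\<gamma> f))" "b \<in> - (path_image (\<gamma> e) \<union> path_image (\<gamma> f))" for a b
  proof (rule Janiszewski[OF _ _ int])
    show "connected_component (- path_image (\<gamma> e)) a b" "connected_component (- path_image (\<gamma> f)) a b"
      using that connected_arc_complement[OF arc[OF assms(1)]] connected_arc_complement[OF arc[OF assms(2)]]
      by (auto simp: connected_iff_connected_component)
  qed (use arc assms in \<open>auto simp: compact_arc_image closed_arc_image\<close>)
  thus ?thesis
    by (auto simp: connected_iff_connected_component)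
qed

text \<open>Two arcs do not separate the plane, and deleting finitely many points from a connected
  open set of the plane leaves it connected.\<close>

lemma connected_Compl_K:
  assumes "D \<subseteq> E" "card D \<le> 2"
  shows "connected (- K D)"
proof -
  have "finite D"
    using assms finite_E finite_subset by blast
  \<comment> \<open>A single edge is the case \<open>e = f\<close>.\<close>
  hence "D = {} \<or> (\<exists>e f. D = {e, f})"
    using assms(2) by (auto simp: le_Suc_eq numeral_2_eq_2 card_Suc_eq)
  hence "connected (- (\<Union>e\<in>D. path_image (\<gamma> e)))"
    using connected_Compl_two_arcs assms(1) by auto
  moreover have "open (- (\<Union>e\<in>D. path_image (\<gamma> e)))"
    using \<open>finite D\<close> assms(1) arc by (intro open_Compl closed_UN) (auto simp: closed_arc_image)
  moreover have "- K D = - (\<Union>e\<in>D. path_image (\<gamma> e)) - p ` V"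
    by (auto simp: K_def)
  ultimately show ?thesis
    using finite_V by (auto intro: connected_open_delete_finite)
qed

text \<open>
  Otherwise \<open>f\<close> is closed and open in the complement of the at most two arcs touched by it (and of the
  vertices), which is connected.
\<close>

lemma face_touches_three:
  assumes f: "f \<in> components (- K E)" "g \<in> components (- K E)" "f \<noteq> g"
  shows "3 \<le> card {e \<in> E. touches f e}"
proof (rule ccontr)
  define D where "D = {e \<in> E. touches f e}"
  assume "\<not> 3 \<le> card {e \<in> E. touches f e}"
  hence con: "connected (- K D)"
    by (intro connected_Compl_K) (auto simp: D_def)
  have DE: "D \<subseteq> E" by (auto simp: D_def)
  have sub: "- K E \<subseteq> - K D" using K_mono[OF DE] by blast
  have fg: "f \<subseteq> - K E" "g \<subseteq> - K E" "f \<noteq> {}" "g \<noteq> {}" "f \<inter> g = {}"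
    using f in_components_subset in_components_nonempty components_nonoverlap by metis+
  \<comment> \<open>A limit point of \<open>f\<close> in \<open>K E\<close> but off
    \<open>K D\<close> would lie on the open arc of an edge that \<open>f\<close> touches, and
    \<open>D\<close> contains all such edges.\<close>
  have "closure f \<inter> - K D \<subseteq> f"
  proof
    fix y assume y: "y \<in> closure f \<inter> - K D"
    show "y \<in> f"
    proof (rule ccontr)
      assume "y \<notin> f"
      hence "y \<in> K E"
        using y closure_component_subset[OF closed_K[OF order_refl] f(1)] by auto
      then obtain e where "e \<in> E" "y \<in> inner e" "e \<notin> D"
        using y by (auto simp: K_eq[OF order_refl] K_eq[OF DE])
      thus False
        using y by (auto simp: D_def touches_def)
    qed
  qed
  hence "f = - K D \<inter> closure f"
    using fg(1) sub closure_subset by blast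
  hence cl: "closedin (top_of_set (- K D)) f"
    by (metis closed_closure closedin_closed_Int)
  have "open f"
    using f(1) closed_K[OF order_refl] open_components open_Compl by blast
  hence "openin (top_of_set (- K D)) f"
    using fg(1) sub by (intro open_subset) auto
  hence "f = - K D"
    using con cl fg(3) by (auto simp: connected_clopen)
  thus False
    using fg sub by blast
qed

text \<open>Once \<open>e\<close> is erased, its open arc joins up with \<open>f\<close> through a
  common limit point.\<close>

lemma component_inner:
  assumes e: "e \<in> E" and f: "f \<in> components (- K E)" "touches f e" "x \<in> f" and y: "y \<in> inner e"
  shows "connected_component (- K (E - {e})) x y"
proof -
  have F: "E - {e} \<subseteq> E" "e \<notin> E - {e}" by auto
  obtain w where w: "w \<in> closure f" "w \<in> inner e"
    using f(2) by (auto simp: touches_def)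
  have "f \<subseteq> - K E" "connected f"
    using f(1) in_components_subset in_components_connected by auto
  moreover have "inner e \<inter> K (E - {e}) = {}"
    using inner_disjoint_K e by blast
  moreover have "connected (inner e \<union> insert w f)"
  proof (rule connected_Un)
    show "connected (insert w f)"
      using \<open>connected f\<close> w(1) closure_subset[of f]
      by (intro connected_intermediate_closure[of f "insert w f"]) auto
  qed (use w connected_inner[OF e] in auto)
  moreover have "inner e \<union> insert w f = inner e \<union> f"
    using w(2) by auto
  moreover have "- K E \<subseteq> - K (E - {e})"
    using K_mono[OF F(1)] by blast
  ultimately show ?thesis
    unfolding connected_component_def using f(3) y by (intro exI[of _ "inner e \<union> f"]) auto
qed

text \<open>
  If \<open>e\<close> is a bridge, the rest of the drawing splits into two closed sets, each meeting the arc of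
  \<open>e\<close> in one point, so that Janiszewski's theorem applies twice.
\<close>

lemma connected_component_Compl_bridge:
  assumes e: "e \<in> E" "e = {a, b}" and npc: "\<not> path_component (K (E - {e})) (p a) (p b)"
    and xy: "x \<notin> K E" "y \<notin> K E" "connected_component (- K (E - {e})) x y"
  shows "connected_component (- K E) x y"
proof -
  define F where "F = E - {e}"
  have FE: "F \<subseteq> E" by (auto simp: F_def)
  have fin: "finite F" using finite_E by (simp add: F_def)
  \<comment> \<open>\<open>A\<close> is the part of the remaining drawing reachable from
    \<open>p a\<close>. An arc that meets \<open>A\<close> lies in it, so the rest splits into two
    finite unions of closed pieces, \<open>K1\<close> inside \<open>A\<close> and \<open>K2\<close>
    off it.\<close>
  define A where "A = path_component_set (K F) (p a)"
  define K1 where "K1 = p ` {v \<in> V. p v \<in> A} \<union> (\<Union>g\<in>{g \<in> F. path_image (\<gamma> g) \<subseteq> A}. path_image (\<gamma> g))"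
  define K2 where "K2 = p ` {v \<in> V. p v \<notin> A} \<union> (\<Union>g\<in>{g \<in> F. \<not> path_image (\<gamma> g) \<subseteq> A}. path_image (\<gamma> g))"
  have disjA: "path_image (\<gamma> g) \<inter> A = {}" if g: "g \<in> F" "\<not> path_image (\<gamma> g) \<subseteq> A" for g
  proof (rule ccontr)
    assume "path_image (\<gamma> g) \<inter> A \<noteq> {}"
    then obtain z where z: "z \<in> path_image (\<gamma> g)" "path_component (K F) (p a) z"
      by (auto simp: A_def)
    have "path_component (K F) z w" if "w \<in> path_image (\<gamma> g)" for w
    proof (rule path_component_of_subset[of "path_image (\<gamma> g)"])
      show "path_component (path_image (\<gamma> g)) z w"
        using z(1) that arc g(1) FE path_connected_path_image
        by (metis arc_imp_path path_connected_component subsetD)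
    qed (use g in \<open>auto simp: K_def\<close>)
    hence "path_image (\<gamma> g) \<subseteq> A"
      using z(2) by (auto simp: A_def intro: path_component_trans)
    thus False using g(2) by simp
  qed
  have K12: "K F = K1 \<union> K2"
    by (auto simp: K_def K1_def K2_def)
  have A1: "K1 \<subseteq> A" and A2: "K2 \<inter> A = {}"
    using disjA by (auto simp: K1_def K2_def)
  have cl: "closed K1" "closed K2"
    unfolding K1_def K2_def using fin FE arc finite_V
    by (intro closed_Un closed_UN; auto intro: finite_imp_closed closed_arc_image)+
  have aV: "a \<in> V" "b \<in> V" using edge[OF e(1)] e(2) by auto
  have "p a \<in> A" "p b \<notin> A"
    using npc aV by (auto simp: A_def F_def path_component_refl_eq K_def)
  hence ab: "p a \<in> K1" "p a \<notin> K2" "p b \<in> K2" "p b \<notin> K1"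
    using A1 A2 aV by (auto simp: K1_def K2_def)
  have int: "path_image (\<gamma> e) \<inter> K F = {p a, p b}"
    using arc_Int_K[of e F] e FE by (auto simp: F_def)
  have KE: "K E = K2 \<union> (K1 \<union> path_image (\<gamma> e))"
    using K_insert[of e F] e(1) K12 by (auto simp: F_def insert_absorb)
  have ccF: "connected_component (- K F) x y"
    using xy(3) by (simp add: F_def)
  have cc1: "connected_component (- K1) x y" and cc2: "connected_component (- K2) x y"
    using K12 by (auto intro!: connected_component_of_subset[OF ccF])
  have cce: "connected_component (- path_image (\<gamma> e)) x y"
    using connected_arc_complement[OF arc[OF e(1)]] xy(1,2) KE
    by (auto simp: connected_iff_connected_component)
  have comp: "compact (path_image (\<gamma> e))"
    using arc[OF e(1)] by (simp add: compact_arc_image)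
  have ecl: "compact K1" 
    using closed_Int_compact[OF cl(1) compact_K[OF FE]] K12 by (simp add: Int_absorb2)
  have pe: "path_image (\<gamma> e) \<inter> K1 = {p a}" "(path_image (\<gamma> e) \<union> K1) \<inter> K2 = {p b}"
    using int ab K12 A1 A2 by auto
  have "connected_component (- (path_image (\<gamma> e) \<union> K1)) x y"
    by (rule Janiszewski[OF comp cl(1) _ cce cc1]) (simp add: pe)
  from Janiszewski[OF compact_Un[OF comp ecl] cl(2) _ this cc2]
  have "connected_component (- ((path_image (\<gamma> e) \<union> K1) \<union> K2)) x y"
    by (simp add: pe)
  thus ?thesis
    by (simp add: KE Un_ac)
qed

text \<open>
  If \<open>e\<close> closes a cycle, two of the three faces are on the same side of it; as the cycle meets the
  drawing without \<open>e\<close> in a connected set, Janiszewski's theorem connects these two faces.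
\<close>

lemma edge_touched_twice:
  assumes e: "e \<in> E"
    and f: "f1 \<in> components (- K E)" "f2 \<in> components (- K E)" "f3 \<in> components (- K E)"
    and t: "touches f1 e" "touches f2 e" "touches f3 e"
  shows "f1 = f2 \<or> f1 = f3 \<or> f2 = f3"
proof -
  obtain a b where ab: "e = {a, b}"
    using edge[OF e] by (auto simp: card_2_iff)
  obtain w where w: "w \<in> inner e" using inner_nonempty[OF e] by blast
  obtain x1 x2 x3 where x: "x1 \<in> f1" "x2 \<in> f2" "x3 \<in> f3"
    using f in_components_nonempty by (metis ex_in_conv)
  have cc: "connected_component (- K (E - {e})) x1 x2" "connected_component (- K (E - {e})) x1 x3"
    "connected_component (- K (E - {e})) x2 x3"
    using component_inner[OF e f(1) t(1) x(1) w] component_inner[OF e f(2) t(2) x(2) w]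
      component_inner[OF e f(3) t(3) x(3) w]
    by (meson connected_component_sym connected_component_trans)+
  have xK: "x1 \<notin> K E" "x2 \<notin> K E" "x3 \<notin> K E"
    using x f in_components_subset by blast+
  have eqI: "g = h" if "g \<in> components (- K E)" "h \<in> components (- K E)" "y \<in> g" "z \<in> h"
    "connected_component (- K E) y z" for g h y z
    using that joinable_components_eq[of _ "- K E" g h] unfolding connected_component_def by blast
  show ?thesis
  proof (cases "path_component (K (E - {e})) (p a) (p b)")
    case False
    thus ?thesis
      using connected_component_Compl_bridge[OF e ab False xK(1,2) cc(1)] eqI f x by blast
  next
    case True
    have F: "E - {e} \<subseteq> E" "e \<notin> E - {e}" by auto
    obtain P c where P: "connected P" "P \<subseteq> K (E - {e})"  "p a \<in> P" "p b \<in> P"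
      and c: "simple_path c" "pathfinish c = pathstart c"
      "path_image c = P \<union> path_image (\<gamma> e)" "P \<inter> path_image (\<gamma> e) = {p a, p b}"
      using edge_cycle[OF e F ab True] by metis
    let ?J = "path_image c"
    have KE: "K E = ?J \<union> K (E - {e})"
      using K_insert[of e "E - {e}"] e P(2) c(3) by (auto simp: insert_absorb)
    have int: "?J \<inter> K (E - {e}) = P"
          proof -
      have "path_image (\<gamma> e) \<inter> K (E - {e}) = {p a, p b}"
        using arc_Int_K[OF e F] ab by simp
      thus ?thesis
        using P(2-4) by (simp add: c(3) Int_Un_distrib2 Int_absorb2 insert_absorb)
    qed
    have sep: "connected_component (- K E) x y"
      if "connected_component (- K (E - {e})) x y" "connected_component (- ?J) x y" for x y
      unfolding KE
      by (rule Janiszewski) (use that c(1) closed_K[OF F(1)] int P(1) in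
          \<open>auto simp: compact_simple_path_image\<close>)
    have io: "connected_component (- ?J) x y" if xy: "{x, y} \<subseteq> inside ?J \<or> {x, y} \<subseteq> outside ?J" for x y
    proof -
      obtain S where "S = inside ?J \<or> S = outside ?J" "x \<in> S" "y \<in> S"
        using xy by blast
      moreover have "connected (inside ?J)" "connected (outside ?J)"
        using Jordan_inside_outside[OF c(1,2)] by auto
      ultimately show ?thesis
        unfolding connected_component_def using inside_no_overlap outside_no_overlap by blast
    qed
    have "x \<in> inside ?J \<union> outside ?J" if "x \<notin> K E" for x
      using that KE by (simp add: inside_Un_outside)
    hence "{x1, x2} \<subseteq> inside ?J \<or> {x1, x2} \<subseteq> outside ?J \<or> {x1, x3} \<subseteq> inside ?J \<or> {x1, x3} \<subseteq> outside ?J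
      \<or> {x2, x3} \<subseteq> inside ?J \<or> {x2, x3} \<subseteq> outside ?J"
      using xK by blast
    hence "connected_component (- ?J) x1 x2 \<or> connected_component (- ?J) x1 x3 \<or>
      connected_component (- ?J) x2 x3"
      using io by blast
    thus ?thesis
      using sep cc eqI f x by blast
  qed
qed

text \<open>Double counting the touching pairs gives that \<open>3 * card R\<close> is at most
  \<open>2 * card E\<close>; with Euler's inequality this bounds \<open>card E\<close> by
  \<open>3 * card V - 6\<close>. If \<open>R\<close> has at most one face, so that
  \<open>face_touches_three\<close> lacks a second one, Euler's inequality alone suffices.\<close>

theorem card_edges_le: "card E \<le> 3 * card V"
proof (cases "V = {}")
  case True
  hence "E = {}" using edge by fastforce
  thus ?thesis by simp
next
  case False
  obtain R where R: "finite R" "R \<subseteq> components (- K E)" "card E + 2 \<le> card R + card V"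
    using many_components[OF False] .
  show ?thesis
  proof (cases "card R \<le> 1")
    case True
    thus ?thesis using R(3) by simp
  next
    case False
    have "3 * card R = (\<Sum>f\<in>R. 3)" by simp
    also have "\<dots> \<le> (\<Sum>f\<in>R. card {e \<in> E. touches f e})"
    proof (rule sum_mono)
      fix f assume "f \<in> R"
      moreover obtain g where "g \<in> R" "g \<noteq> f"
        using False R(1) \<open>f \<in> R\<close> by (metis card_le_Suc0_iff_eq One_nat_def)
      ultimately show "3 \<le> card {e \<in> E. touches f e}"
        using R(2) face_touches_three[of f g] by blast
    qed
    also have "\<dots> = (\<Sum>e\<in>E. card {f \<in> R. touches f e})"
      using R(1) finite_E by (rule sum_multicount_gen[where R = touches and k = "\<lambda>e. card {f \<in> R. touches f e}", OF _ _ ballI[OF refl]])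
    also have "\<dots> \<le> (\<Sum>e\<in>E. 2)"
    proof (rule sum_mono, rule ccontr)
      fix e assume e: "e \<in> E" "\<not> card {f \<in> R. touches f e} \<le> 2"
      hence "3 \<le> card {f \<in> R. touches f e}" by simp
      then obtain S where "S \<subseteq> {f \<in> R. touches f e}" "card S = 3"
        by (meson obtain_subset_with_card_n)
      then obtain f1 f2 f3 where "{f1, f2, f3} \<subseteq> {f \<in> R. touches f e}" "f1 \<noteq> f2" "f1 \<noteq> f3" "f2 \<noteq> f3"
        by (auto simp: card_3_iff)
      thus False using edge_touched_twice[OF e(1), of f1 f2 f3] R(2) by auto
    qed
    finally show ?thesis using R(3) by simp
  qed
qed

end

section \<open>Apex graphs over noncrossing chords\<close>

definition apex_edges :: "nat \<Rightarrow> (nat \<times> nat) set \<Rightarrow> nat set set" where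
  "apex_edges n A = {{0, k} |k. 1 \<le> k \<and> k \<le> n} \<union> {{i, j} |i j. (i, j) \<in> A}"

text \<open>\<open>Im z - (Re z)^2\<close> measures the height above the parabola; its product form
  makes two chords comparable and vanishes only at the ends of the chord.\<close>

lemma chord_points:
  fixes i j :: real
  assumes "z \<in> closed_segment (Complex i (i\<^sup>2)) (Complex j (j\<^sup>2))" "i < j"
  shows "i \<le> Re z" "Re z \<le> j" "Im z - (Re z)\<^sup>2 = (Re z - i) * (j - Re z)"
proof -
  obtain s where s: "0 \<le> s" "s \<le> 1"
    and z: "z = (1 - s) *\<^sub>R Complex i (i\<^sup>2) + s *\<^sub>R Complex j (j\<^sup>2)"
    using assms(1) by (auto simp: in_segment)
  have Re: "Re z = i + s * (j - i)" and Im: "Im z = (1 - s) * i\<^sup>2 + s * j\<^sup>2"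
    by (auto simp: z algebra_simps)
  have "0 \<le> s * (j - i)" "s * (j - i) \<le> 1 * (j - i)"
    using s assms(2) by (intro mult_nonneg_nonneg mult_right_mono; simp)+
  thus "i \<le> Re z" "Re z \<le> j"
    by (simp_all add: Re)
  show "Im z - (Re z)\<^sup>2 = (Re z - i) * (j - Re z)"
    unfolding Re Im by (simp add: algebra_simps power2_eq_square)
qed

text \<open>With the apex at depth \<open>h > k^2\<close>, the depth of \<open>z\<close> below the
  parabola is \<open>(1 - s) * (h - s * k^2)\<close>. The second factor is positive, so the spoke
  reaches the parabola only at its end.\<close>

lemma spoke_points:
  fixes k h :: real
  assumes "z \<in> closed_segment (Complex 0 (- h)) (Complex k (k\<^sup>2))" "k\<^sup>2 < h"
  obtains s where "0 \<le> s" "s \<le> 1" "Re z = s * k" "Im z = s * (k\<^sup>2 + h) - h"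
    "Im z \<le> (Re z)\<^sup>2" "Im z = (Re z)\<^sup>2 \<longrightarrow> s = 1"
proof -
  obtain s where s: "0 \<le> s" "s \<le> 1"
    and z: "z = (1 - s) *\<^sub>R Complex 0 (- h) + s *\<^sub>R Complex k (k\<^sup>2)"
    using assms(1) by (auto simp: in_segment)
  have Re: "Re z = s * k" and Im: "Im z = s * (k\<^sup>2 + h) - h"
    by (auto simp: z algebra_simps)
  have eq: "(Re z)\<^sup>2 - Im z = (1 - s) * (h - s * k\<^sup>2)"
    unfolding Re Im by (simp add: algebra_simps power2_eq_square)
  have "s * k\<^sup>2 \<le> 1 * k\<^sup>2"
    using s by (intro mult_right_mono) auto
  hence pos: "h - s * k\<^sup>2 > 0"
    using assms(2) by simp
  show ?thesis
  proof (rule that[OF s Re Im])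
    have "0 \<le> (1 - s) * (h - s * k\<^sup>2)"
      using s pos by simp
    thus "Im z \<le> (Re z)\<^sup>2"
      using eq by simp
    show "Im z = (Re z)\<^sup>2 \<longrightarrow> s = 1"
    proof
      assume "Im z = (Re z)\<^sup>2"
      hence "(1 - s) * (h - s * k\<^sup>2) = 0"
        using eq by simp
      thus "s = 1"
        unfolding mult_eq_0_iff using pos by linarith
    qed
  qed
qed

text \<open>
  The vertices \<open>k > 0\<close> lie on the parabola, so that noncrossing pairs give noncrossing chords, and
  the apex \<open>0\<close> lies so far below the parabola that it sees all of them.
\<close>

definition position :: "nat \<Rightarrow> nat \<Rightarrow> complex" where
  "position n k = (if k = 0 then Complex 0 (- (real n ^ 2 + 1)) else Complex (real k) (real k ^ 2))"

text \<open>Noncrossing intervals have disjoint interiors or are nested. In the interior of the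
  inner interval the outer chord is strictly higher above the parabola, so a common point is an end
  of the inner chord; its height is then zero, which makes it an end of the outer chord as
  well.\<close>

lemma chord_Int_chord:
  fixes i j k l :: real
  assumes "i < j" "k < l" "\<not> (i < k \<and> k < j \<and> j < l)" "\<not> (k < i \<and> i < l \<and> l < j)"
    "(i, j) \<noteq> (k, l)"
    and z: "z \<in> closed_segment (Complex i (i\<^sup>2)) (Complex j (j\<^sup>2))"
      "z \<in> closed_segment (Complex k (k\<^sup>2)) (Complex l (l\<^sup>2))"
  shows "(Re z = i \<or> Re z = j) \<and> (Re z = k \<or> Re z = l)"
proof -
  define t where "t = Re z"
  have 1: "i \<le> t" "t \<le> j" "k \<le> t" "t \<le> l"
    and eq: "(t - i) * (j - t) = (t - k) * (l - t)"
    using chord_points[OF z(1) assms(1)] chord_points[OF z(2) assms(2)] by (simp_all add: t_def)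
  have nested: "t = c \<or> t = d"
    if "a \<le> c" "d \<le> b" "(a, b) \<noteq> (c, d)" "c \<le> t" "t \<le> d" "(t - a) * (b - t) = (t - c) * (d - t)"
    for a b c d :: real
  proof (rule ccontr)
    assume "\<not> ?thesis"
    hence *: "0 < t - c" "0 < d - t"
      using that by auto
    have "(t - c) * (d - t) < (t - a) * (b - t)"
    proof (cases "a < c")
      case True
      have "(t - c) * (d - t) < (t - a) * (d - t)"
        using * True by (intro mult_strict_right_mono) auto
      also have "\<dots> \<le> (t - a) * (b - t)"
        using * that by (intro mult_left_mono) auto
      finally show ?thesis .
    next
      case False
      hence "(t - c) * (d - t) < (t - c) * (b - t)"
        using * that by (intro mult_strict_left_mono) auto
      thus ?thesis
        using False that by simp
    qed
    thus False
      using that by simp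
  qed
  consider "j \<le> k" | "l \<le> i" | "i \<le> k" "l \<le> j" | "k \<le> i" "j \<le> l"
    using assms(1-4) by linarith
  hence "(t = i \<or> t = j) \<and> (t = k \<or> t = l)"
  proof cases
    case 3
    hence "t = k \<or> t = l"
      using nested[of i k l j] 1 eq assms(5) by auto
    thus ?thesis
      using eq by auto
  next
    case 4
    hence "t = i \<or> t = j"
      using nested[of k i j l] 1 eq assms(5) by auto
    thus ?thesis
      using eq by auto
  qed (use 1 in auto)
  thus ?thesis
    by (simp add: t_def)
qed

lemma apex_planar:
  assumes A: "\<And>i j. (i, j) \<in> A \<Longrightarrow> 1 \<le> i \<and> i < j \<and> j \<le> n"
    and noncrossing: "\<And>i j k l. \<lbrakk>(i, j) \<in> A; (k, l) \<in> A; i < k; k < j; j < l\<rbrakk> \<Longrightarrow> False"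
  shows "planar_graph {..n} (apex_edges n A)"
proof -
  let ?E = "apex_edges n A"
  let ?p = "position n"
  define h where "h = real n ^ 2 + 1"
  \<comment> \<open>An edge is a set, so \<open>Min\<close> and \<open>Max\<close> provide a
    direction for its segment.\<close>
  define \<gamma> where "\<gamma> e = linepath (?p (Min e)) (?p (Max e))" for e
  have p0: "?p 0 = Complex 0 (- h)" and pk: "k > 0 \<Longrightarrow> ?p k = Complex (real k) (real k ^ 2)" for k
    by (auto simp: position_def h_def)
  \<comment> \<open>The case \<open>k = l\<close> keeps the spokes below the parabola, and distinct
    \<open>k\<close>, \<open>l\<close> keep two spokes apart.\<close>
  have hk: "real k * real l < h" if "k \<le> n" "l \<le> n" for k l
  proof -
    have "real k * real l \<le> real n * real n"
      using that by (intro mult_mono) auto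
    thus ?thesis
      by (simp add: h_def power2_eq_square)
  qed
  have h0: "h > 0"
    unfolding h_def by (rule add_nonneg_pos) auto
  have "Re (?p k) = real k" for k
    by (simp add: position_def)
  hence inj: "inj ?p"
    by (metis injI of_nat_eq_iff)
  have cases: thesis if "e \<in> ?E" "\<And>k. \<lbrakk>e = {0, k}; 1 \<le> k; k \<le> n\<rbrakk> \<Longrightarrow> thesis"
    "\<And>i j. \<lbrakk>e = {i, j}; (i, j) \<in> A\<rbrakk> \<Longrightarrow> thesis" for e thesis
    using that by (auto simp: apex_edges_def)
  have im: "path_image (\<gamma> {i, j}) = closed_segment (?p i) (?p j)" if "i < j" for i j
    using that by (simp add: \<gamma>_def min_def max_def)
  have ordered: "\<exists>i j. e = {i, j} \<and> i < j \<and> j \<le> n" if "e \<in> ?E" for e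
    using that
  proof (rule cases)
    fix k assume "e = {0, k}" "1 \<le> k" "k \<le> n"
    thus ?thesis by (intro exI[of _ 0] exI[of _ k]) auto
  next
    fix i j assume "e = {i, j}" "(i, j) \<in> A"
    thus ?thesis using A by (intro exI[of _ i] exI[of _ j]) auto
  qed
  have simple: "simple_graph {..n} ?E"
    using ordered by (fastforce simp: simple_graph_def)
  have spoke: "\<exists>s. Re z = s * real k \<and> Im z = s * (real k ^ 2 + h) - h \<and> Im z \<le> (Re z)\<^sup>2 \<and>
      (Im z = (Re z)\<^sup>2 \<longrightarrow> s = 1)"
    if "1 \<le> k" "k \<le> n" "z \<in> closed_segment (?p 0) (?p k)" for k z
  proof -
    have "z \<in> closed_segment (Complex 0 (- h)) (Complex (real k) ((real k)\<^sup>2))" "(real k)\<^sup>2 < h"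
      using that hk[of k k] by (simp_all add: p0 pk power2_eq_square)
    from spoke_points[OF this] show ?thesis
      by metis
  qed
  have spoke_vertex: "m = 0 \<or> m = k"
    if k: "1 \<le> k" "k \<le> n" and m: "?p m \<in> closed_segment (?p 0) (?p k)" for k m
  proof (cases "m = 0")
    case False
    obtain s where "Re (?p m) = s * real k" "Im (?p m) = (Re (?p m))\<^sup>2 \<longrightarrow> s = 1"
      using spoke[OF k m] by blast
    thus ?thesis
      using False by (simp add: pk)
  qed simp
  have chord_vertex: "m = i \<or> m = j"
    if ij: "1 \<le> i" "i < j" and m: "?p m \<in> closed_segment (?p i) (?p j)" for i j m
  proof -
    have *: "?p m \<in> closed_segment (Complex (real i) (real i ^ 2)) (Complex (real j) (real j ^ 2))"
      using m ij by (simp add: pk)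
    note c = chord_points[OF *]
    have "m \<noteq> 0"
    proof
      assume "m = 0"
      hence "real i \<le> 0" using c(1) ij by (simp add: p0)
      thus False using ij by simp
    qed
    hence "(real m - real i) * (real j - real m) = 0"
      using c(3) ij by (simp add: pk)
    thus ?thesis
      by auto
  qed
  have vertex: "path_image (\<gamma> e) \<inter> ?p ` {..n} = ?p ` e" if e: "e \<in> ?E" for e
  proof -
    obtain i j where ij: "e = {i, j}" "i < j" "j \<le> n"
      using ordered[OF e] by blast
    have "m \<in> e" if "?p m \<in> closed_segment (?p i) (?p j)" for m
      using e
    proof (rule cases)
      fix k assume "e = {0, k}" "1 \<le> k" "k \<le> n"
      moreover from this have "i = 0" "j = k"
        using ij by (auto simp: doubleton_eq_iff)
      ultimately show ?thesis
        using spoke_vertex[of k m] that by auto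
    next
      fix a b assume "e = {a, b}" "(a, b) \<in> A"
      hence "1 \<le> i"
        using ij A[of a b] by (auto simp: doubleton_eq_iff)
      thus ?thesis
        using chord_vertex[of i j m] that ij by auto
    qed
    thus ?thesis
      using ij by (auto simp: im)
  qed
  have spoke_spoke: "z = ?p 0"
    if k: "1 \<le> k" "k \<le> n" "1 \<le> l" "l \<le> n" "k \<noteq> l"
      and z: "z \<in> closed_segment (?p 0) (?p k)" "z \<in> closed_segment (?p 0) (?p l)" for k l z
  proof -
    obtain s where s: "Re z = s * real k" "Im z = s * (real k ^ 2 + h) - h"
      using spoke[of k z] k z by blast
    obtain s' where s': "Re z = s' * real l" "Im z = s' * (real l ^ 2 + h) - h"
      using spoke[of l z] k z by blast
    have e1: "s * real k = s' * real l" and e2: "s * (real k ^ 2 + h) = s' * (real l ^ 2 + h)"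
      using s s' by simp_all
    \<comment> \<open>Eliminating \<open>s'\<close> leaves
      \<open>s * ((l - k) * (h - k * l)) = 0\<close>, where only \<open>s\<close> can
      vanish.\<close>
    have "s * real l * (real k ^ 2 + h) = (s' * real l) * (real l ^ 2 + h)"
      using arg_cong[OF e2, of "\<lambda>x. x * real l"] by (simp only: mult_ac)
    also have "\<dots> = s * real k * (real l ^ 2 + h)"
      by (simp add: e1)
    finally have "s * ((real l - real k) * (h - real k * real l)) = 0"
      by (simp add: algebra_simps power2_eq_square)
    hence "s = 0"
      using k hk[of k l] by simp
    thus ?thesis
      using s by (simp add: p0 complex_eq_iff)
  qed
  have spoke_chord: "k \<in> {i, j} \<and> z = ?p k"
    if k: "1 \<le> k" "k \<le> n" "1 \<le> i" "i < j"
      and z: "z \<in> closed_segment (?p 0) (?p k)" "z \<in> closed_segment (?p i) (?p j)" for k i j z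
  proof -
    obtain s where s: "Re z = s * real k" "Im z = s * (real k ^ 2 + h) - h"
      "Im z \<le> (Re z)\<^sup>2" "Im z = (Re z)\<^sup>2 \<longrightarrow> s = 1"
      using spoke[of k z] k z by blast
    have *: "z \<in> closed_segment (Complex (real i) (real i ^ 2)) (Complex (real j) (real j ^ 2))"
      using z k by (simp add: pk)
    note c = chord_points[OF *]
    \<comment> \<open>A chord is on or above the parabola and a spoke on or below it, so they can
      meet only on the parabola, that is, at a vertex.\<close>
    have "0 \<le> (Re z - real i) * (real j - Re z)"
      using c k by (intro mult_nonneg_nonneg) auto
    moreover have eq: "Im z - (Re z)\<^sup>2 = (Re z - real i) * (real j - Re z)"
      using c(3) k by simp
    ultimately have Im: "Im z = (Re z)\<^sup>2"
      using s(3) by linarith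
    hence "s = 1" "(Re z - real i) * (real j - Re z) = 0"
      using s(4) eq by simp_all
    hence "Re z = real k" "Re z = real i \<or> Re z = real j"
      using s(1) by auto
    thus ?thesis
      using Im k by (auto simp: pk complex_eq_iff)
  qed
  have chord_chord: "z \<in> ?p ` ({i, j} \<inter> {k, l})"
    if A': "(i, j) \<in> A" "(k, l) \<in> A" "(i, j) \<noteq> (k, l)"
      and z: "z \<in> closed_segment (?p i) (?p j)" "z \<in> closed_segment (?p k) (?p l)" for i j k l z
  proof -
    note Ai = A[OF A'(1)] A[OF A'(2)]
    have *: "z \<in> closed_segment (Complex (real i) (real i ^ 2)) (Complex (real j) (real j ^ 2))"
      "z \<in> closed_segment (Complex (real k) (real k ^ 2)) (Complex (real l) (real l ^ 2))"
      using z Ai by (simp_all add: pk)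
    have "(Re z = i \<or> Re z = j) \<and> (Re z = k \<or> Re z = l)"
      by (rule chord_Int_chord[OF _ _ _ _ _ *])
        (use noncrossing[OF A'(1,2)] noncrossing[OF A'(2,1)] Ai A'(3) in auto)
    moreover have "Im z - (Re z)\<^sup>2 = (Re z - i) * (j - Re z)"
      using chord_points[OF *(1)] Ai by simp
    ultimately obtain m where "m \<in> {i, j} \<inter> {k, l}" "Re z = real m" "Im z = (Re z)\<^sup>2"
      by fastforce
    moreover from this have "z = ?p m"
      using Ai by (auto simp: pk complex_eq_iff)
    ultimately show ?thesis
      by blast
  qed
  have crossing: "path_image (\<gamma> e) \<inter> path_image (\<gamma> f) = ?p ` (e \<inter> f)"
    if ef: "e \<in> ?E" "f \<in> ?E" "e \<noteq> f" for e f
  proof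
    show "?p ` (e \<inter> f) \<subseteq> path_image (\<gamma> e) \<inter> path_image (\<gamma> f)"
      using vertex[OF ef(1)] vertex[OF ef(2)] by blast
    show "path_image (\<gamma> e) \<inter> path_image (\<gamma> f) \<subseteq> ?p ` (e \<inter> f)"
    proof
      fix z assume z: "z \<in> path_image (\<gamma> e) \<inter> path_image (\<gamma> f)"
      show "z \<in> ?p ` (e \<inter> f)"
        using ef(1)
      proof (rule cases)
        fix k assume k: "e = {0, k}" "1 \<le> k" "k \<le> n"
        show ?thesis
          using ef(2)
        proof (rule cases)
          fix l assume l: "f = {0, l}" "1 \<le> l" "l \<le> n"
          hence "z = ?p 0"
            using k z ef(3) by (intro spoke_spoke[of k l]) (auto simp: im)
          thus ?thesis using k l by blast
        next
          fix i j assume "f = {i, j}" "(i, j) \<in> A"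
          thus ?thesis
            using k z spoke_chord[of k i j z] A by (auto simp: im)
        qed
      next
        fix i j assume ij: "e = {i, j}" "(i, j) \<in> A"
        show ?thesis
          using ef(2)
        proof (rule cases)
          fix k assume "f = {0, k}" "1 \<le> k" "k \<le> n"
          thus ?thesis
            using ij z spoke_chord[of k i j z] A by (auto simp: im)
        next
          fix k l assume "f = {k, l}" "(k, l) \<in> A"
          thus ?thesis
            using ij z ef(3) chord_chord[of i j k l z] A by (auto simp: im)
        qed
      qed
    qed
  qed
  have arcs: "arc (\<gamma> e) \<and> {pathstart (\<gamma> e), pathfinish (\<gamma> e)} = ?p ` e" if e: "e \<in> ?E" for e
  proof -
    obtain i j where ij: "e = {i, j}" "i < j"
      using ordered[OF e] by blast
    hence "?p i \<noteq> ?p j"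
      using inj by (auto dest: injD)
    thus ?thesis
      using ij by (simp add: \<gamma>_def min_def max_def arc_linepath)
  qed
  have "inj_on ?p {..n}"
    using inj by (rule inj_on_subset) simp
  hence "planar_drawing {..n} ?E ?p \<gamma>"
    unfolding planar_drawing_def using arcs vertex by (intro conjI ballI impI crossing) simp_all
  thus ?thesis
    using simple by (auto simp: planar_graph_def)
qed

section \<open>Two-local layouts\<close>

lemma pigeonhole_pair:
  assumes "finite C" "g ` I \<subseteq> C" "card C < card I"
  obtains i j where "i \<in> I" "j \<in> I" "i \<noteq> j" "g i = g j"
proof -
  have "card (g ` I) < card I"
    using assms card_mono[of C "g ` I"] by linarith
  hence "\<not> inj_on g I"
    by (rule pigeonhole)
  thus ?thesis
    using that by (auto simp: inj_on_def)
qed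

text \<open>An abstract 2-local layout: \<open>pos\<close> gives places in the ordering, and
  \<open>q a b\<close> is the queue of the edge \<open>ab\<close>. Places are integers so that
  negation reverses the order. Having a neighbour stands for being a vertex of the graph.\<close>

locale two_local =
  fixes adj :: "'a \<Rightarrow> 'a \<Rightarrow> bool" and pos :: "'a \<Rightarrow> int" and q :: "'a \<Rightarrow> 'a \<Rightarrow> 'q"
  assumes adj_sym: "adj a b \<Longrightarrow> adj b a"
    and q_sym: "q a b = q b a"
    and pos_inj: "adj a c \<Longrightarrow> adj b d \<Longrightarrow> pos a = pos b \<Longrightarrow> a = b"
    and adj_irrefl: "\<not> adj a a"
    and no_nest: "\<lbrakk>adj a d; adj b c; q a d = q b c; pos a < pos b; pos b < pos c; pos c < pos d\<rbrakk> \<Longrightarrow> False"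
    and two: "\<lbrakk>adj v a; adj v b; adj v c\<rbrakk> \<Longrightarrow> q v a = q v b \<or> q v a = q v c \<or> q v b = q v c"
    and finite_labels: "finite {q v a |a. adj v a}"
begin

text \<open>Reversing the order preserves nesting, so whatever is shown to the right of a vertex
  transfers to its left by interpretation.\<close>

lemma mirror: "two_local adj (\<lambda>v. - pos v) q"
proof
  show False if "adj a d" "adj b c" "q a d = q b c" "- pos a < - pos b" "- pos b < - pos c" "- pos c < - pos d"
    for a b c d
    using no_nest[of d a c b] that adj_sym q_sym by (metis neg_less_iff_less)
qed (use adj_sym q_sym pos_inj adj_irrefl two finite_labels in \<open>auto intro: adj_sym\<close>)

lemma pos_neq: "adj a c \<Longrightarrow> adj b d \<Longrightarrow> a \<noteq> b \<Longrightarrow> pos a \<noteq> pos b"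
  using pos_inj by blast

lemma no_nest_left:
  assumes "adj z m" "adj a b" "q z m = q a b" "pos z < pos a" "pos z < pos b" "pos a < pos m" "pos b < pos m"
  shows False
proof (cases "pos a < pos b")
  case True
  thus ?thesis using no_nest[of z m a b] assms by blast
next
  case False
  moreover have "pos a \<noteq> pos b"
    using assms(2) pos_neq[of a b b a] adj_sym adj_irrefl by blast
  ultimately show ?thesis 
    using no_nest[of z m b a] assms adj_sym[of a b] q_sym[of a b] by simp
qed

lemma card_labels: "card {q v a |a. adj v a} \<le> 2"
proof (rule ccontr)
  assume "\<not> ?thesis"
  hence "3 \<le> card {q v a |a. adj v a}"
    by simp
  then obtain S where "S \<subseteq> {q v a |a. adj v a}" "card S = 3"
    by (meson obtain_subset_with_card_n)
  then obtain x y z where "{x, y, z} \<subseteq> {q v a |a. adj v a}" "x \<noteq> y" "x \<noteq> z" "y \<noteq> z"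
    by (auto simp: card_3_iff)
  then obtain a b c where "adj v a" "adj v b" "adj v c" "q v a = x" "q v b = y" "q v c = z"
    by auto
  thus False
    using two[of v a b c] \<open>x \<noteq> y\<close> \<open>x \<noteq> z\<close> \<open>y \<noteq> z\<close> by simp
qed

section \<open>Alike pairs of common neighbours of two poles\<close>

text \<open>The rightmost of the four vertices has an edge to a pole that covers the other pair.\<close>

lemma two_pairs_right:
  assumes adj: "adj x x'" "adj y y'" "q x x' = c" "q y y' = c"
    and distinct: "{x, x'} \<inter> {y, y'} = {}"
    and poles: "\<And>m. m \<in> {x, x', y, y'} \<Longrightarrow>
      \<exists>z. adj z m \<and> q z m = c \<and> pos z < pos x \<and> pos z < pos x' \<and> pos z < pos y \<and> pos z < pos y'"
  shows False
proof -
  have ne: "pos x \<noteq> pos y" "pos x \<noteq> pos y'" "pos x' \<noteq> pos y" "pos x' \<noteq> pos y'"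
    using distinct pos_neq adj adj_sym by blast+
  consider "pos y < pos x" "pos y' < pos x" | "pos y < pos x'" "pos y' < pos x'"
    | "pos x < pos y" "pos x' < pos y" | "pos x < pos y'" "pos x' < pos y'"
    using ne by linarith
  thus False
  proof cases
    case 1
    obtain z where "adj z x" "q z x = c" "pos z < pos y" "pos z < pos y'" using poles[of x] by blast
    thus False using no_nest_left[of z x y y'] 1 adj by simp
  next
    case 2
    obtain z where "adj z x'" "q z x' = c" "pos z < pos y" "pos z < pos y'" using poles[of x'] by blast
    thus False using no_nest_left[of z x' y y'] 2 adj by simp
  next
    case 3
    obtain z where "adj z y" "q z y = c" "pos z < pos x" "pos z < pos x'" using poles[of y] by blast
    thus False using no_nest_left[of z y x x'] 3 adj by simp
  next
    case 4
    obtain z where "adj z y'" "q z y' = c" "pos z < pos x" "pos z < pos x'" using poles[of y'] by blast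
    thus False using no_nest_left[of z y' x x'] 4 adj by simp
  qed
qed

text \<open>Say \<open>x\<close> comes before \<open>y\<close>. If \<open>x'\<close> and
  \<open>y'\<close> are left of \<open>z\<close>, then \<open>yy'\<close> covers \<open>zx\<close>;
  otherwise \<open>zy\<close> covers \<open>xx'\<close>.\<close>

lemma two_pairs_across:
  assumes adj: "adj z x" "adj z y" "adj x x'" "adj y y'"
    and c: "q z x = c" "q z y = c" "q x x' = c" "q y y' = c"
    and distinct: "x \<noteq> y" "z \<notin> {x', y'}"
    and order: "pos z < pos x" "pos z < pos y" "pos x' < pos x" "pos x' < pos y" "pos y' < pos x" "pos y' < pos y"
    and side: "pos x' < pos z \<longleftrightarrow> pos y' < pos z"
  shows False
proof -
  have *: False
    if "adj z x" "adj z y" "adj x x'" "adj y y'" "q z x = c" "q z y = c" "q x x' = c" "q y y' = c"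
      "z \<notin> {x', y'}" "pos z < pos x" "pos x < pos y" "pos x' < pos x" "pos y' < pos y"
      "pos x' < pos z \<longleftrightarrow> pos y' < pos z" for x y x' y'
  proof (cases "pos y' < pos z")
    case True
    thus False
      using no_nest[of y' y z x] that adj_sym q_sym by metis
  next
    case False
    hence "pos z < pos x'"
      using that pos_neq[of z x x' x] adj_sym by fastforce
    thus False
      using no_nest[of z y x' x] that adj_sym q_sym by metis
  qed
  have "pos x \<noteq> pos y"
    using distinct adj pos_neq adj_sym by blast
  thus False
    using *[of x y x' y'] *[of y x y' x'] adj c distinct order side by fastforce
qed

definition region :: "'a \<Rightarrow> 'a \<Rightarrow> 'a \<Rightarrow> bool \<times> bool" where
  "region a b v = (pos a < pos v, pos b < pos v)"

text \<open>Otherwise all four edges share a queue, in which the edge from \<open>a\<close> to the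
  later of \<open>x\<close>, \<open>y\<close> covers the edge from \<open>b\<close> to the
  earlier.\<close>

lemma no_common_right:
  assumes adj: "adj a x" "adj a y" "adj b x" "adj b y" and "x \<noteq> y"
    and ab: "pos a < pos b" "pos b < pos x" "pos b < pos y"
    and c: "q a x = q a y" "q b x = q b y"
  shows "q a x \<noteq> q b x"
proof
  assume eq: "q a x = q b x"
  have "pos x \<noteq> pos y"
    using adj assms(5) pos_neq adj_sym by blast
  thus False
    using no_nest[of a y b x] no_nest[of a x b y] adj ab c eq by fastforce
qed

text \<open>The poles use different queues at \<open>x\<close>, so \<open>xx'\<close> lies in one of
  these. If \<open>x'\<close> is also right of \<open>b\<close>, the same holds there, and each of
  the four vertices is joined to a pole within the queue of \<open>xx'\<close>. Otherwise the pole
  \<open>z\<close> with \<open>zx\<close> in that queue gives the situation of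
  \<open>two_pairs_across\<close>.\<close>

lemma no_pattern_right:
  assumes ab: "adj a b" "pos a < pos b"
    and tx: "adj a x" "adj b x" "adj a x'" "adj b x'" "adj x x'"
    and ty: "adj a y" "adj b y" "adj a y'" "adj b y'" "adj y y'"
    and distinct: "{x, x'} \<inter> {y, y'} = {}"
    and c: "q a x = q a y" "q b x = q b y" "q a x' = q a y'" "q b x' = q b y'" "q x x' = q y y'"
    and reg: "region a b x = region a b y" "region a b x' = region a b y'"
    and right: "pos b < pos x"
  shows False
proof -
  have r: "pos b < pos y" "pos b < pos x' \<longleftrightarrow> pos b < pos y'" "pos a < pos x' \<longleftrightarrow> pos a < pos y'"
    using reg right by (auto simp: region_def)
  have xy: "x \<noteq> y" "x' \<noteq> y'" using distinct by auto
  have D: "q a x \<noteq> q b x"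
    using no_common_right[of a x y b] tx ty xy ab right r c by blast
  have Q: "q x x' = q a x \<or> q x x' = q b x"
    using two[of x a b x'] D tx adj_sym q_sym by metis
  show False
  proof (cases "pos b < pos x'")
    case True
    have D': "q a x' \<noteq> q b x'"
      using no_common_right[of a x' y' b] tx ty xy ab True r c by blast
    have Q': "q x x' = q a x' \<or> q x x' = q b x'"
      using two[of x' a b x] D' tx adj_sym q_sym by metis
    show False
    proof (rule two_pairs_right[of x x' y y'])
      have ord: "pos z < pos x \<and> pos z < pos x' \<and> pos z < pos y \<and> pos z < pos y'" if "z = a \<or> z = b" for z
        using that ab right r True by auto
      show "\<exists>z. adj z m \<and> q z m = q x x' \<and> pos z < pos x \<and> pos z < pos x' \<and> pos z < pos y \<and> pos z < pos y'"
        if "m \<in> {x, x', y, y'}" for m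
      proof -
        have "\<exists>z. (z = a \<or> z = b) \<and> adj z m \<and> q z m = q x x'"
          using that Q Q' tx ty c by auto
        thus ?thesis
          using ord by blast
      qed
    qed (use tx ty distinct c in auto)
  next
    case False
    obtain z where z: "z = a \<or> z = b" "q z x = q x x'"
      using Q by metis
    have le: "pos x' \<le> pos b" "pos y' \<le> pos b"
      using False r by auto
    have nz: "z \<notin> {x', y'}"
      using z tx ty adj_irrefl by auto
    have ne: "pos x' \<noteq> pos a" "pos y' \<noteq> pos a" "pos x' \<noteq> pos b" "pos y' \<noteq> pos b"
      using pos_neq[of x' x a b] pos_neq[of y' y a b] pos_neq[of x' x b a] pos_neq[of y' y b a]
        tx ty ab adj_sym adj_irrefl by metis+
    show False
      by (rule two_pairs_across[of z x y x' y' "q x x'"])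
        (use z tx ty c xy nz le ne ab right r in auto)
  qed
qed

lemma no_pattern_left:
  assumes ab: "adj a b" "pos a < pos b"
    and tx: "adj a x" "adj b x" "adj a x'" "adj b x'" "adj x x'"
    and ty: "adj a y" "adj b y" "adj a y'" "adj b y'" "adj y y'"
    and distinct: "{x, x'} \<inter> {y, y'} = {}"
    and c: "q a x = q a y" "q b x = q b y" "q a x' = q a y'" "q b x' = q b y'" "q x x' = q y y'"
    and reg: "region a b x = region a b y" "region a b x' = region a b y'"
    and left: "pos x < pos a"
  shows False
proof -
  interpret m: two_local adj "\<lambda>v. - pos v" q
    by (rule mirror)
  have ne: "pos v \<noteq> pos a" "pos v \<noteq> pos b" if "adj a v" "adj b v" for v
    using that ab adj_sym adj_irrefl pos_inj by metis+
  \<comment> \<open>Reversal exchanges the poles and negates the comparisons, which are never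
    equalities for a common neighbour.\<close>
  have *: "m.region b a v = (\<not> snd (region a b v), \<not> fst (region a b v))" if "adj a v" "adj b v" for v
    using ne[OF that] by (simp add: region_def m.region_def) linarith
  show False
    by (rule m.no_pattern_right[OF adj_sym[OF ab(1)] _ tx(2,1,4,3,5) ty(2,1,4,3,5) distinct c(2,1,4,3,5)])
      (use ab left reg * tx ty in simp_all)
qed

text \<open>Without such a \<open>z\<close>, any common neighbour \<open>v\<close> between the poles
  has \<open>av\<close> and \<open>bv\<close> in different queues, and \<open>bv\<close> is not in
  the queue of \<open>ab\<close> because \<open>aw\<close> would cover it. Two of the pairs look
  alike. Outside the poles this is excluded by the patterns above; between them, all four vertices
  are joined to one pole within the queue of \<open>XX'\<close>, and \<open>two_pairs_right\<close>
  or its mirror image applies.\<close>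

lemma fan:
  assumes ab: "adj a b" "pos a < pos b"
    and far: "adj a w" "pos b < pos w" "q a w = q a b"
    and fin: "finite I" "512 < card I"
    and t: "\<And>i. i \<in> I \<Longrightarrow> adj a (x i) \<and> adj b (x i) \<and> adj a (x' i) \<and> adj b (x' i) \<and> adj (x i) (x' i)"
    and distinct: "\<And>i j. i \<in> I \<Longrightarrow> j \<in> I \<Longrightarrow> i \<noteq> j \<Longrightarrow> {x i, x' i} \<inter> {x j, x' j} = {}"
  shows "\<exists>z. adj a z \<and> adj b z \<and> pos a < pos z \<and> pos z < pos b \<and> q a z = q b z \<and> q a z \<noteq> q a b"
proof (rule ccontr)
  assume none: "\<not> ?thesis"
  let ?Qa = "{q a v |v. adj a v}" and ?Qb = "{q b v |v. adj b v}"
  let ?C = "?Qa \<times> ?Qb \<times> ?Qa \<times> ?Qb \<times> (UNIV :: bool set) \<times> (UNIV :: (bool \<times> bool) set) \<times> (UNIV :: (bool \<times> bool) set)"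
  \<comment> \<open>The edges \<open>x x'\<close> may use unboundedly many queues, so it is only
    recorded whether the queue is that of \<open>a x\<close>. As \<open>x\<close> meets just two
    queues, this will determine it.\<close>
  define g where "g i = (q a (x i), q b (x i), q a (x' i), q b (x' i), q (x i) (x' i) = q a (x i),
    region a b (x i), region a b (x' i))" for i
  \<comment> \<open>Two queues for each of four pole edges, one truth value, and two regions with
    four values each: \<open>2^5 * 4^2 = 512\<close> patterns.\<close>
  have "card ?C \<le> 2 * (2 * (2 * (2 * (2 * (4 * 4)))))"
    unfolding card_cartesian_product using card_labels
    by (intro mult_mono) (auto simp flip: UNIV_Times_UNIV simp: card_cartesian_product)
  hence "card ?C < card I"
    using fin(2) by simp
  moreover have "finite ?C"
    by (intro finite_cartesian_product finite_labels) auto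
  moreover have "g ` I \<subseteq> ?C"
    using t by (auto simp: g_def)
  ultimately obtain i j where ij: "i \<in> I" "j \<in> I" "i \<noteq> j" "g i = g j"
    using pigeonhole_pair[of ?C g I] by metis
  define X X' Y Y' where "X = x i" "X' = x' i" "Y = x j" "Y' = x' j"
  note defs = this
  have tx: "adj a X" "adj b X" "adj a X'" "adj b X'" "adj X X'"
    and ty: "adj a Y" "adj b Y" "adj a Y'" "adj b Y'" "adj Y Y'"
    using t[OF ij(1)] t[OF ij(2)] by (auto simp: defs)
  have dis: "{X, X'} \<inter> {Y, Y'} = {}"
    using distinct[OF ij(1-3)] by (simp add: defs)
  have c: "q a X = q a Y" "q b X = q b Y" "q a X' = q a Y'" "q b X' = q b Y'"
    "q X X' = q a X \<longleftrightarrow> q Y Y' = q a Y"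
    and reg: "region a b X = region a b Y" "region a b X' = region a b Y'"
    using ij(4) unfolding g_def defs prod.inject by blast+
  have sym: "adj v u" if "adj u v" for u v
    using that by (rule adj_sym)
  have ne: "pos v \<noteq> pos a" "pos v \<noteq> pos b" if "adj a v" "adj b v" for v
    using that ab adj_sym adj_irrefl pos_inj by metis+
  have between: "q a v \<noteq> q b v \<and> q b v \<noteq> q a b" if "adj a v" "adj b v" "pos a < pos v" "pos v < pos b" for v
  proof -
    have "q b v \<noteq> q a b"
      using no_nest[of a w v b] that far q_sym[of b v] sym by metis
    thus ?thesis
      using none that by metis
  qed
  \<comment> \<open>Outside the poles this needs a second vertex \<open>u\<close> that looks like
    \<open>v\<close>; between them \<open>between\<close> suffices.\<close>
  have D: "q a v \<noteq> q b v"
    if vu: "adj a v" "adj b v" "adj a u" "adj b u" "u \<noteq> v" "q a v = q a u" "q b v = q b u"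
      "region a b v = region a b u" for u v
  proof -
    consider "pos b < pos v" | "pos v < pos a" | "pos a < pos v" "pos v < pos b"
      using ne[OF vu(1,2)] by linarith
    thus ?thesis
    proof cases
      case 1
      thus ?thesis
        using no_common_right[of a v u b] vu ab by (simp add: region_def)
    next
      case 2
      interpret m: two_local adj "\<lambda>v. - pos v" q
        by (rule mirror)
      have "pos u < pos a"
        using 2 vu ne[of u] ab by (simp add: region_def)
      thus ?thesis
        using m.no_common_right[of b v u a] vu ab 2 by force
    next
      case 3
      thus ?thesis using between vu by blast
    qed
  qed
  have XY: "X \<noteq> Y" "X' \<noteq> Y'" using dis by auto
  have DX: "q a X \<noteq> q b X" "q a X' \<noteq> q b X'"
    using D[of X Y] D[of X' Y'] tx ty c reg XY by auto
  have Q: "q X X' = q a X \<or> q X X' = q b X" "q Y Y' = q a Y \<or> q Y Y' = q b Y"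
    "q X X' = q a X' \<or> q X X' = q b X'"
    using two[of X a b X'] two[of Y a b Y'] two[of X' a b X] DX c tx ty sym q_sym by metis+
  hence cc: "q X X' = q Y Y'"
    using c DX by metis
  have out: False if "pos b < pos X \<or> pos X < pos a"
    using that no_pattern_right[OF ab tx ty dis c(1-4) cc reg] no_pattern_left[OF ab tx ty dis c(1-4) cc reg]
    by blast
  \<comment> \<open>The same exclusion with the roles of \<open>X\<close> and \<open>X'\<close>, and
    of \<open>Y\<close> and \<open>Y'\<close>, exchanged.\<close>
  have out': False if "pos b < pos X' \<or> pos X' < pos a"
    using that no_pattern_right[of a b X' X Y' Y] no_pattern_left[of a b X' X Y' Y] ab tx ty dis c(1-4) cc reg
      sym q_sym[of X X'] q_sym[of Y Y'] by (metis insert_commute)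
  have pX: "pos a < pos X" "pos X < pos b" "pos a < pos X'" "pos X' < pos b"
    using out out' ne tx by (meson linorder_neqE)+
  hence pY: "pos a < pos Y" "pos Y < pos b" "pos a < pos Y'" "pos Y' < pos b"
    using reg ne[of Y] ne[of Y'] ty by (auto simp: region_def)
  \<comment> \<open>\<open>b\<close> meets at most two queues, one of them that of
    \<open>ab\<close>, which neither \<open>bX\<close> nor \<open>bX'\<close> uses.\<close>
  have qb: "q b X' = q b X"
    using two[of b a X X'] between[of X] between[of X'] tx pX sym[OF ab(1)] q_sym[of a b] by metis
  show False
  proof (cases "q X X' = q b X")
    case True
    interpret m: two_local adj "\<lambda>v. - pos v" q
      by (rule mirror)
    show False
      by (rule m.two_pairs_right[of X X' Y Y' "q X X'"])
        (use tx ty dis cc True qb c pX pY in \<open>auto intro!: exI[of _ b]\<close>)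
  next
    case False
    hence "q X X' = q a X" "q X X' = q a X'"
      using Q qb by auto
    thus False
      by (intro two_pairs_right[of X X' Y Y' "q X X'"])
        (use tx ty dis cc c pX pY in \<open>auto intro!: exI[of _ a]\<close>)
  qed
qed

section \<open>Many fanned edges at a common apex\<close>

definition fanned :: "'a \<Rightarrow> 'a \<Rightarrow> bool" where
  "fanned a b \<longleftrightarrow> adj a b \<and> (\<exists>(I :: nat set) x x'. finite I \<and> 512 < card I \<and>
     (\<forall>i\<in>I. adj a (x i) \<and> adj b (x i) \<and> adj a (x' i) \<and> adj b (x' i) \<and> adj (x i) (x' i)) \<and>
     (\<forall>i\<in>I. \<forall>j\<in>I. i \<noteq> j \<longrightarrow> {x i, x' i} \<inter> {x j, x' j} = {}))"

lemma fanned_adj: "fanned a b \<Longrightarrow> adj a b"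
  unfolding fanned_def by (rule conjunct1)

lemma fannedI:
  fixes I :: "nat set"
  assumes "adj a b" "finite I" "512 < card I"
    and "\<And>i. i \<in> I \<Longrightarrow> adj a (x i)" "\<And>i. i \<in> I \<Longrightarrow> adj a (x' i)"
    and "\<And>i. i \<in> I \<Longrightarrow> adj b (x i)" "\<And>i. i \<in> I \<Longrightarrow> adj b (x' i)"
    and "\<And>i. i \<in> I \<Longrightarrow> adj (x i) (x' i)"
    and "\<And>i j. \<lbrakk>i \<in> I; j \<in> I; i \<noteq> j\<rbrakk> \<Longrightarrow> {x i, x' i} \<inter> {x j, x' j} = {}"
  shows "fanned a b"
  unfolding fanned_def
  by (rule conjI, rule assms(1), rule exI[of _ I], rule exI[of _ x], rule exI[of _ x'])
    (use assms in blast)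

text \<open>The assumption of \<open>fan\<close> on the far vertex \<open>w\<close>, on either side
  of \<open>u\<close>.\<close>

definition exceeded :: "'a \<Rightarrow> 'a \<Rightarrow> bool" where
  "exceeded u v \<longleftrightarrow> (\<exists>w. adj u w \<and> q u w = q u v \<and>
     (pos u < pos v \<and> pos v < pos w \<or> pos w < pos v \<and> pos v < pos u))"

lemma inner_apex:
  assumes "fanned u v" "exceeded u v" "pos u < pos v"
  obtains z where "adj u z" "adj v z" "pos u < pos z" "pos z < pos v" "q u z = q v z" "q u z \<noteq> q u v"
proof -
  obtain I :: "nat set" and x x' where f: "adj u v" "finite I" "512 < card I"
    "\<forall>i\<in>I. adj u (x i) \<and> adj v (x i) \<and> adj u (x' i) \<and> adj v (x' i) \<and> adj (x i) (x' i)"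
    "\<forall>i\<in>I. \<forall>j\<in>I. i \<noteq> j \<longrightarrow> {x i, x' i} \<inter> {x j, x' j} = {}"
    using assms(1) unfolding fanned_def by (elim conjE exE) (rule that)
  obtain w where w: "adj u w" "pos v < pos w" "q u w = q u v"
    using assms(2,3) by (auto simp: exceeded_def)
  have "\<exists>z. adj u z \<and> adj v z \<and> pos u < pos z \<and> pos z < pos v \<and> q u z = q v z \<and> q u z \<noteq> q u v"
    by (rule fan[OF f(1) assms(3) w f(2,3), of x x']) (use f(4,5) in blast)+
  thus ?thesis
    using that by blast
qed

text \<open>If \<open>uv\<close> and \<open>uy\<close> lay in different queues, then
  \<open>uz\<close> and \<open>zv\<close> would be in the queue of \<open>uy\<close>, and
  \<open>uz'\<close> and \<open>z'y\<close> in that of \<open>uv\<close>. Now \<open>uy\<close>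
  covers \<open>zv\<close> if \<open>y\<close> is farther right, and \<open>uv\<close> covers
  \<open>z'y\<close> otherwise.\<close>

lemma exceeded_right_label:
  assumes "fanned u v" "exceeded u v" "pos u < pos v" "fanned u y" "exceeded u y" "pos u < pos y"
  shows "q u v = q u y"
proof (rule ccontr)
  assume ne: "q u v \<noteq> q u y"
  obtain z where z: "adj u z" "adj v z" "pos u < pos z" "pos z < pos v" "q u z = q v z" "q u z \<noteq> q u v"
    by (rule inner_apex[OF assms(1-3)])
  obtain z' where z': "adj u z'" "adj y z'" "pos u < pos z'" "pos z' < pos y" "q u z' = q y z'" "q u z' \<noteq> q u y"
    by (rule inner_apex[OF assms(4-6)])
  have a: "adj u v" "adj u y"
    using assms by (auto simp: fanned_adj)
  have c: "q u z = q u y" "q u z' = q u v"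
    using two[OF a z(1)] two[OF a z'(1)] z(6) z'(6) ne by auto
  have "pos v \<noteq> pos y"
    using ne a pos_inj adj_sym by metis
  thus False
    using no_nest[of u y z v] no_nest[of u v z' y] a z z' c q_sym[of v z] q_sym[of y z'] adj_sym
    by (metis linorder_neqE)
qed

text \<open>The inner apex of \<open>v\<close> shows that the two queues at \<open>v\<close> are the
  two queues at \<open>u\<close>.\<close>

lemma exceeded_label:
  assumes v: "fanned u v" "exceeded u v" "pos u < pos v"
    and "adj v v'" "adj u z" "q u z \<noteq> q u v"
  shows "q v v' = q u v \<or> q v v' = q u z"
proof -
  obtain y where y: "adj u y" "adj v y" "q u y = q v y" "q u y \<noteq> q u v"
    by (rule inner_apex[OF v])
  have a: "adj u v"
    using v by (simp add: fanned_adj)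
  have "q u y = q u z"
    using two[OF a y(1) assms(5)] y(4) assms(6) by auto
  moreover have "q v v' = q u v \<or> q v v' = q v y"
    using two[OF adj_sym[OF a] y(2) assms(4)] y(3,4) q_sym[of v u] by metis
  ultimately show ?thesis
    using y(3) by simp
qed

text \<open>Otherwise \<open>uz\<close> would cover \<open>xv\<close>, where \<open>x\<close> is the
  inner apex of \<open>v\<close>: both edges are in the second queue at \<open>u\<close>.\<close>

lemma inner_apex_before:
  assumes v: "fanned u v" "exceeded u v" "pos u < pos v" "pos v < pos y"
    and y: "fanned u y" "exceeded u y" "adj u z" "q u z \<noteq> q u y"
  shows "pos z < pos v"
proof (rule ccontr)
  assume nl: "\<not> pos z < pos v"
  obtain x where x: "adj u x" "adj v x" "pos u < pos x" "pos x < pos v" "q u x = q v x" "q u x \<noteq> q u v"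
    by (rule inner_apex[OF v(1-3)])
  have a: "adj u v"
    using v by (simp add: fanned_adj)
  have same: "q u v = q u y"
    using exceeded_right_label[OF v(1-3) y(1,2)] v by simp
  hence "q u x = q u z"
    using two[OF a x(1) y(3)] x(6) y(4) by auto
  moreover have "pos z \<noteq> pos v"
    using pos_inj[of z u v u] y a adj_sym same by metis
  ultimately show False
    using no_nest[of u z x v] nl x y adj_sym[OF x(2)] q_sym[of v x] by simp
qed

lemma no_exceeded_edge_right:
  assumes "adj v v'"
    and v: "fanned u v" "exceeded u v" "pos u < pos v" "pos v < pos y"
    and v': "fanned u v'" "exceeded u v'" "pos u < pos v'" "pos v' < pos y"
    and y: "fanned u y" "exceeded u y"
  shows False
proof -
  have uy: "pos u < pos y" using v by simp
  obtain z where z: "adj u z" "adj y z" "pos u < pos z" "pos z < pos y" "q u z = q y z" "q u z \<noteq> q u y"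
    by (rule inner_apex[OF y uy])
  have same: "q u v = q u y"
    by (rule exceeded_right_label[OF v(1-3) y uy])
  \<comment> \<open>Since \<open>z\<close>, like \<open>u\<close>, lies left of \<open>v\<close> and
    \<open>v'\<close>, both \<open>uy\<close> and \<open>zy\<close> cover \<open>vv'\<close>, and
    one of them is in its queue.\<close>
  have "pos z < pos v" "pos z < pos v'"
    using inner_apex_before[OF v y z(1,6)] inner_apex_before[OF v' y z(1,6)] .
  moreover have "q v v' = q u y \<or> q v v' = q z y"
    using exceeded_label[OF v(1-3) assms(1) z(1)] z same q_sym[of y z] by simp
  ultimately show False
    using no_nest_left[of u y v v'] no_nest_left[of z y v v'] y z v v' assms(1) adj_sym[OF z(2)]
    by (auto simp: fanned_adj)
qed

text \<open>\<open>yy'\<close> covers both \<open>uv\<close> and \<open>uz\<close>, where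
  \<open>z\<close> is the inner apex of \<open>v\<close>, and these represent the two queues
  available to \<open>yy'\<close>.\<close>

lemma no_exceeded_edge_across:
  assumes v: "fanned u v" "exceeded u v" "pos u < pos v" "pos v < pos y"
    and y: "fanned u y" "exceeded u y" "adj y y'" "pos y' < pos u"
  shows False
proof -
  have uy: "pos u < pos y" using v by simp
  obtain z where z: "adj u z" "pos u < pos z" "pos z < pos v" "q u z \<noteq> q u v"
    by (rule inner_apex[OF v(1-3)])
  have same: "q u v = q u y"
    by (rule exceeded_right_label[OF v(1-3) y(1,2) uy])
  have "adj u v"
    using v by (simp add: fanned_adj)
  moreover have "q y' y = q u v \<or> q y' y = q u z"
    using exceeded_label[OF y(1,2) uy y(3) z(1)] z same q_sym[of y y'] by simp
  ultimately show False
    using no_nest[of y' y u v] no_nest[of y' y u z] v y z adj_sym[OF y(3)] by auto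
qed

lemma no_two_exceeded_edges_across:
  assumes v: "fanned u v" "exceeded u v" "pos u < pos v" "adj v v'" "pos v' < pos u"
    and y: "fanned u y" "exceeded u y" "pos u < pos y" "adj y y'" "pos y' < pos u"
    and "v \<noteq> y"
  shows False
proof -
  have "pos v \<noteq> pos y"
    using pos_inj[of v v' y y'] v y assms(11) by blast
  thus False
    using no_exceeded_edge_across[of u v y y'] no_exceeded_edge_across[of u y v v'] v y by linarith
qed

text \<open>One of the four vertices lies to the right of both ends of the other edge and serves as
  \<open>y\<close> in \<open>no_exceeded_edge_right\<close>.\<close>

lemma no_two_exceeded_edges_right:
  assumes adj: "adj x x'" "adj y y'" "{x, x'} \<inter> {y, y'} = {}"
    and ex: "\<And>v. v \<in> {x, x', y, y'} \<Longrightarrow> fanned u v \<and> exceeded u v \<and> pos u < pos v"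
  shows False
proof -
  have "pos x \<noteq> pos y" "pos x \<noteq> pos y'" "pos x' \<noteq> pos y" "pos x' \<noteq> pos y'"
    using adj pos_neq adj_sym by blast+
  then consider "pos y < pos x" "pos y' < pos x" | "pos y < pos x'" "pos y' < pos x'"
    | "pos x < pos y" "pos x' < pos y" | "pos x < pos y'" "pos x' < pos y'"
    by linarith
  thus False
  proof cases
    case 1
    thus False using no_exceeded_edge_right[of y y' u x] adj ex by simp
  next
    case 2
    thus False using no_exceeded_edge_right[of y y' u x'] adj ex by simp
  next
    case 3
    thus False using no_exceeded_edge_right[of x x' u y] adj ex by simp
  next
    case 4
    thus False using no_exceeded_edge_right[of x x' u y'] adj ex by simp
  qed
qed

text \<open>For each side of \<open>u\<close> and each queue at \<open>u\<close>, only the farthest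
  of the 18 ends can fail to be exceeded, so at most 4 fail. At least 5 of the 9 edges have both
  ends exceeded, and two of these agree among the 4 ways in which the ends can lie relative to
  \<open>u\<close>.\<close>

theorem no_nine_fanned_edges:
  fixes w :: "nat \<Rightarrow> bool \<Rightarrow> 'a"
  assumes w: "\<And>i b. i < 9 \<Longrightarrow> fanned u (w i b)"
    and edge: "\<And>i. i < 9 \<Longrightarrow> adj (w i False) (w i True)"
    and inj: "\<And>i j b c. \<lbrakk>i < 9; j < 9; w i b = w j c\<rbrakk> \<Longrightarrow> i = j \<and> b = c"
  shows False
proof -
  have uw: "adj u (w i b)" if "i < 9" for i b
    using fanned_adj[OF w[OF that]] .
  have nu: "pos (w i b) \<noteq> pos u" if "i < 9" for i b
    using pos_neq[of "w i b" u u "w i b"] uw[OF that] adj_sym adj_irrefl by metis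
  define N where "N = {(i, b). i < 9 \<and> \<not> exceeded u (w i b)}"
  define label where "label = (\<lambda>(i, b). (pos u < pos (w i b), q u (w i b)))"
  have finN: "finite N"
    by (rule finite_subset[of _ "{..<9} \<times> UNIV"]) (auto simp: N_def)
  have "inj_on label N"
  proof (rule inj_onI, rule ccontr)
    fix m n assume mn: "m \<in> N" "n \<in> N" "label m = label n" "m \<noteq> n"
    obtain i b j c where ib: "m = (i, b)" "n = (j, c)"
      by (cases m, cases n) auto
    have ij: "i < 9" "j < 9" "\<not> exceeded u (w i b)" "\<not> exceeded u (w j c)"
      using mn ib by (auto simp: N_def)
    have "w i b \<noteq> w j c"
      using inj[OF ij(1,2)] mn(4) ib by auto
    hence "pos (w i b) \<noteq> pos (w j c)"
      using pos_neq uw ij adj_sym by blast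
    moreover have "q u (w i b) = q u (w j c)" "pos u < pos (w i b) \<longleftrightarrow> pos u < pos (w j c)"
      using mn(3) ib by (auto simp: label_def)
    ultimately show False
      using ij uw[OF ij(1)] uw[OF ij(2)] nu[OF ij(1), of b] nu[OF ij(2), of c]
      unfolding exceeded_def by (metis linorder_neqE)
  qed
  moreover have "label ` N \<subseteq> UNIV \<times> {q u a |a. adj u a}"
    using uw by (auto simp: label_def N_def)
  ultimately have "card N \<le> card ((UNIV :: bool set) \<times> {q u a |a. adj u a})"
    by (intro card_inj_on_le[of label]) (auto intro: finite_labels)
  also have "\<dots> \<le> 4"
    using card_labels[of u] by (simp add: card_cartesian_product)
  finally have "card N \<le> 4" .
  hence "card (fst ` N) \<le> 4"
    using card_image_le[OF finN, of fst] by simp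
  moreover have "card {..<9::nat} - card (fst ` N) \<le> card ({..<9} - fst ` N)"
    using finN by (intro diff_card_le_card_Diff) auto
  ultimately have G: "card (UNIV :: (bool \<times> bool) set) < card ({..<9} - fst ` N)"
    by (simp flip: UNIV_Times_UNIV add: card_cartesian_product)
  obtain i j where ij: "i \<in> {..<9} - fst ` N" "j \<in> {..<9} - fst ` N" "i \<noteq> j"
    and side: "(pos u < pos (w i False), pos u < pos (w i True)) = (pos u < pos (w j False), pos u < pos (w j True))"
    by (rule pigeonhole_pair[OF _ _ G, of "\<lambda>i. (pos u < pos (w i False), pos u < pos (w i True))"]) auto
  have lt: "i < 9" "j < 9"
    using ij by auto
  have ex: "exceeded u (w i b)" "exceeded u (w j b)" for b
    using ij lt unfolding N_def by force+
  note f = w[OF lt(1)] w[OF lt(2)]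
  note e = edge[OF lt(1)] edge[OF lt(2)]
  have dis: "w i b \<noteq> w j c" for b c
    using inj[OF lt] ij(3) by blast
  have left: "\<not> pos u < pos (w i b) \<Longrightarrow> pos (w i b) < pos u"
    "\<not> pos u < pos (w j b) \<Longrightarrow> pos (w j b) < pos u" for b
    using nu[OF lt(1), of b] nu[OF lt(2), of b] by linarith+
  interpret m: two_local adj "\<lambda>v. - pos v" q
    by (rule mirror)
  have mex: "m.exceeded u v = exceeded u v" for v
    by (auto simp: m.exceeded_def exceeded_def)
  consider "pos u < pos (w i False)" "pos u < pos (w i True)"
    | "pos u < pos (w i False)" "\<not> pos u < pos (w i True)"
    | "\<not> pos u < pos (w i False)" "pos u < pos (w i True)"
    | "\<not> pos u < pos (w i False)" "\<not> pos u < pos (w i True)"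
    by blast
  thus False
  proof cases
    case 1
    thus False
      using no_two_exceeded_edges_right[of "w i False" "w i True" "w j False" "w j True" u] side f e ex dis by auto
  next
    case 2
    thus False
      using no_two_exceeded_edges_across[of u "w i False" "w i True" "w j False" "w j True"] side f e ex dis left
      by auto
  next
    case 3
    thus False
      using no_two_exceeded_edges_across[of u "w i True" "w i False" "w j True" "w j False"] side f e ex dis left
        adj_sym by auto
  next
    case 4
    hence "\<not> pos u < pos (w j False)" "\<not> pos u < pos (w j True)"
      using side by auto
    with 4 show False
      by (intro m.no_two_exceeded_edges_right[of "w i False" "w i True" "w j False" "w j True" u])
        (use e f ex dis left in \<open>auto simp: mex\<close>)
  qed
qed

end

section \<open>The bounds\<close>

lemma planar_graph_restrict:
  assumes "planar_graph V E" "F \<subseteq> E"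
  shows "planar_graph (\<Union>F) F"
proof -
  obtain p \<gamma> where G: "simple_graph V E" and d: "planar_drawing V E p \<gamma>"
    using assms(1) by (auto simp: planar_graph_def)
  note d' = d[unfolded planar_drawing_def]
  note inj = conjunct1[OF d'] and arcs = bspec[OF conjunct1[OF conjunct2[OF d']]]
    and cross = bspec[OF bspec[OF conjunct2[OF conjunct2[OF d']]], THEN mp]
  have sub: "\<Union>F \<subseteq> V"
    using G assms(2) by (auto simp: simple_graph_def)
  have "simple_graph (\<Union>F) F"
    using G assms(2) finite_subset[OF sub] by (auto simp: simple_graph_def)
  moreover have "planar_drawing (\<Union>F) F p \<gamma>"
    unfolding planar_drawing_def
  proof (intro conjI ballI impI)
    show "inj_on p (\<Union>F)"
      using inj sub by (rule inj_on_subset)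
    fix e assume e: "e \<in> F"
    have "p ` e \<subseteq> p ` \<Union>F" "p ` \<Union>F \<subseteq> p ` V"
      using e sub by blast+
    moreover have "path_image (\<gamma> e) \<inter> p ` V = p ` e"
      using arcs[of e] e assms(2) by blast
    ultimately show "path_image (\<gamma> e) \<inter> p ` \<Union>F = p ` e"
      by blast
    show "arc (\<gamma> e)" "{pathstart (\<gamma> e), pathfinish (\<gamma> e)} = p ` e"
      using arcs[of e] e assms(2) by blast+
    show "path_image (\<gamma> e) \<inter> path_image (\<gamma> f) = p ` (e \<inter> f)" if "f \<in> F" "e \<noteq> f" for f
      using cross[of e f] e that assms(2) by blast
  qed
  ultimately show ?thesis
    by (auto simp: planar_graph_def)
qed

lemma planar_card_edges_le:
  assumes "planar_graph V E"
  shows "card E \<le> 3 * card V"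
proof -
  obtain p \<gamma> where "drawing V E p \<gamma>"
    using assms by (auto simp: planar_graph_def drawing_def)
  thus ?thesis
    by (rule drawing.card_edges_le)
qed

lemma planar_local_queue_layout:
  assumes "planar_graph V E"
  shows "\<exists>r P. local_queue_layout 4 V E r P"
proof -
  have G: "simple_graph V E"
    using assms by (simp add: planar_graph_def)
  hence e: "E \<subseteq> Pow V" "finite V"
    by (auto simp: simple_graph_def)
  obtain t where "\<And>e. e \<in> E \<Longrightarrow> t e \<in> e" "\<And>v. card {e \<in> E. t e = v} \<le> 3"
  proof (rule bounded_tails[of E 3])
    show "finite E"
      using e finite_subset by blast
    show "finite e" if e': "e \<in> E" for e
      using e' e finite_subset by blast
    \<comment> \<open>Hall's condition counts only the ends of \<open>F\<close>, so the subgraph is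
      taken on the vertex set \<open>\<Union>F\<close> instead of \<open>V\<close>.\<close>
    show "card F \<le> 3 * card (\<Union>F)" if F: "F \<subseteq> E" for F
      by (rule planar_card_edges_le[OF planar_graph_restrict[OF assms F]])
    fix s assume "\<And>e. e \<in> E \<Longrightarrow> s e \<in> e" "\<And>v. card {e \<in> E. s e = v} \<le> 3"
    then show thesis
      by (rule that)
  qed
  from tails_imp_local_queue_layout[OF G this] show ?thesis
    by simp
qed

section \<open>From layouts to places and queue labels\<close>

lemma linear_order_position:
  assumes "finite V" "linear_order_on V r" "a \<in> V" "b \<in> V"
  defines "pos \<equiv> \<lambda>v. int (card {w. (w, v) \<in> r})"
  shows "pos a < pos b \<longleftrightarrow> (a, b) \<in> r - Id" and "pos a = pos b \<longleftrightarrow> a = b"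
proof -
  have r: "refl_on V r" "r \<subseteq> V \<times> V" "trans r" "antisym r" "total_on V r"
    using assms(2) by (auto simp: order_on_defs)
  have less: "pos u < pos v" if "(u, v) \<in> r - Id" "u \<in> V" "v \<in> V" for u v
  proof -
    have "{w. (w, v) \<in> r} \<subseteq> V"
      using r(2) by auto
    hence "finite {w. (w, v) \<in> r}"
      using assms(1) finite_subset by blast
    moreover have "{w. (w, u) \<in> r} \<subset> {w. (w, v) \<in> r}"
    proof
      show "{w. (w, u) \<in> r} \<subseteq> {w. (w, v) \<in> r}"
        using that(1) transD[OF r(3)] by blast
      have "(v, v) \<in> r" "(v, u) \<notin> r"
        using refl_onD[OF r(1)] antisymD[OF r(4)] that by auto
      thus "{w. (w, u) \<in> r} \<noteq> {w. (w, v) \<in> r}"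
        by blast
    qed
    ultimately show ?thesis
      unfolding pos_def by (simp add: psubset_card_mono)
  qed
  have "a = b \<or> (a, b) \<in> r - Id \<or> (b, a) \<in> r - Id"
    using r(5) assms(3,4) by (auto simp: total_on_def)
  thus "pos a < pos b \<longleftrightarrow> (a, b) \<in> r - Id" "pos a = pos b \<longleftrightarrow> a = b"
    using less[of a b] less[of b a] assms(3,4) antisymD[OF r(4), of a b] by auto
qed

text \<open>The place of a vertex is the size of its down-set, and the queue of an edge is its class
  in the partition. For a non-edge \<open>THE\<close> is unspecified but still symmetric, as
  \<open>{a, b}\<close> is a set; the conditions other than symmetry constrain \<open>q\<close> on
  edges only.\<close>

lemma local_queue_layout_two_local:
  assumes G: "simple_graph V E" and L: "local_queue_layout 2 V E r P"
  shows "two_local (\<lambda>a b. {a, b} \<in> E) (\<lambda>v. int (card {w. (w, v) \<in> r}))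
    (\<lambda>a b. THE Q. Q \<in> P \<and> {a, b} \<in> Q)"
proof -
  let ?q = "\<lambda>e. THE Q. Q \<in> P \<and> e \<in> Q"
  have finV: "finite V" and edge: "e \<in> E \<Longrightarrow> e \<subseteq> V \<and> card e = 2" for e
    using G by (auto simp: simple_graph_def)
  have r: "linear_order_on V r" and part: "partition_on E P" and queues: "\<And>Q. Q \<in> P \<Longrightarrow> queue r Q"
    and two: "\<And>v. v \<in> V \<Longrightarrow> card {Q \<in> P. \<exists>e\<in>Q. v \<in> e} \<le> 2"
    using L by (auto simp: local_queue_layout_def queue_layout_def)
  have "E \<subseteq> Pow V"
    using edge by blast
  hence "finite E"
    using finV finite_subset by blast
  hence finP: "finite P"
    using part by (rule finite_elements)
  have q: "?q e \<in> P \<and> e \<in> ?q e" if "e \<in> E" for e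
  proof (rule theI')
    show "\<exists>!Q. Q \<in> P \<and> e \<in> Q"
      using that part by (auto simp: partition_on_def disjoint_def)
  qed
  have V: "a \<in> V" "b \<in> V" "a \<noteq> b" if "{a, b} \<in> E" for a b
    using edge[OF that] by auto
  note pos = linear_order_position[OF finV r]
  show ?thesis
  proof
    show False
      if "{a, d} \<in> E" "{b, c} \<in> E" "?q {a, d} = ?q {b, c}"
        "int (card {w. (w, a) \<in> r}) < int (card {w. (w, b) \<in> r})"
        "int (card {w. (w, b) \<in> r}) < int (card {w. (w, c) \<in> r})"
        "int (card {w. (w, c) \<in> r}) < int (card {w. (w, d) \<in> r})" for a b c d
    proof -
      have "(a, b) \<in> r - Id" "(b, c) \<in> r - Id" "(c, d) \<in> r - Id"
        using that(4-6) pos(1)[of a b] pos(1)[of b c] pos(1)[of c d] V[OF that(1)] V[OF that(2)]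
        by simp_all
      hence "nest r {a, d} {b, c}"
        unfolding nest_def nested_inside_def by blast
      moreover have "queue r (?q {a, d})" "{a, d} \<in> ?q {a, d}" "{b, c} \<in> ?q {a, d}"
        using q[OF that(1)] q[OF that(2)] queues that(3) by auto
      ultimately show False
        unfolding queue_def by blast
    qed
    show "?q {v, a} = ?q {v, b} \<or> ?q {v, a} = ?q {v, c} \<or> ?q {v, b} = ?q {v, c}"
      if "{v, a} \<in> E" "{v, b} \<in> E" "{v, c} \<in> E" for v a b c
    proof (rule ccontr)
      assume "\<not> ?thesis"
      hence "card {?q {v, a}, ?q {v, b}, ?q {v, c}} = 3"
        by auto
      moreover have "?q {v, w} \<in> {Q \<in> P. \<exists>e\<in>Q. v \<in> e}" if "{v, w} \<in> E" for w
        using q[OF that] by blast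
      hence "{?q {v, a}, ?q {v, b}, ?q {v, c}} \<subseteq> {Q \<in> P. \<exists>e\<in>Q. v \<in> e}"
        by (simp only: insert_subset that empty_subsetI simp_thms)
      hence "card {?q {v, a}, ?q {v, b}, ?q {v, c}} \<le> card {Q \<in> P. \<exists>e\<in>Q. v \<in> e}"
        using finP by (intro card_mono) auto
      ultimately show False
        using two[OF V(1)[OF that(1)]] by simp
    qed
    show "finite {?q {v, a} |a. {v, a} \<in> E}" for v
      by (rule finite_subset[OF _ finP]) (use q in blast)
    show "a = b" if "{a, c} \<in> E" "{b, d} \<in> E" "int (card {w. (w, a) \<in> r}) = int (card {w. (w, b) \<in> r})"
      for a b c d
      using pos(2)[of a b] V[OF that(1)] V[OF that(2)] that(3) by simp
    show "{a, a} \<notin> E" for a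
      using edge[of "{a, a}"] by auto
  qed (simp_all add: insert_commute)
qed

section \<open>A planar graph without a 2-local layout\<close>

text \<open>
  A block consists of the chord \<open>{1, 2054}\<close>, with 513 triangles at each of its two ends; the
  pigeonhole argument in \<open>fan\<close> distinguishes 512 patterns.
\<close>

definition block :: "(nat \<times> nat) set" where
  "block = {(1, k) |k. 2 \<le> k \<and> k \<le> 1027} \<union> {(k, 2054) |k. 1028 \<le> k \<and> k \<le> 2053} \<union> {(1, 2054)} \<union>
     {(2 * j, 2 * j + 1) |j. 1 \<le> j \<and> j \<le> 1026}"

definition blocks :: "(nat \<times> nat) set" where
  "blocks = {(i * 2054 + a, i * 2054 + b) |i a b. i < 9 \<and> (a, b) \<in> block}"

lemma block_bounds: "(a, b) \<in> block \<Longrightarrow> 1 \<le> a \<and> a < b \<and> b \<le> 2054"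
  by (auto simp: block_def)

lemma block_noncrossing: "\<lbrakk>(a, b) \<in> block; (c, d) \<in> block; a < c; c < b; b < d\<rbrakk> \<Longrightarrow> False"
  by (auto simp: block_def)

text \<open>The nine blocks occupy consecutive intervals of 2054 vertices, 18486 in all, so chords
  of different blocks cannot cross.\<close>

lemma blocks_planar: "planar_graph {..18486} (apex_edges 18486 blocks)"
proof (rule apex_planar)
  show "1 \<le> a \<and> a < b \<and> b \<le> 18486" if "(a, b) \<in> blocks" for a b
    using that by (auto simp: blocks_def dest!: block_bounds)
  show False if ab: "(a, b) \<in> blocks" and cd: "(c, d) \<in> blocks" and o: "a < c" "c < b" "b < d" for a b c d
  proof -
    obtain i a' b' where 1: "a = i * 2054 + a'" "b = i * 2054 + b'" "(a', b') \<in> block"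
      using ab unfolding blocks_def by blast
    obtain j c' d' where 2: "c = j * 2054 + c'" "d = j * 2054 + d'" "(c', d') \<in> block"
      using cd unfolding blocks_def by blast
    note bounds = block_bounds[OF 1(3)] block_bounds[OF 2(3)]
    have "i = j"
    proof (rule linorder_cases[of i j])
      assume "i < j"
      thus ?thesis
        using 1 2 o bounds by linarith
    next
      assume "j < i"
      thus ?thesis
        using 1 2 o bounds by linarith
    qed
    thus False
      using block_noncrossing[OF 1(3) 2(3)] 1 2 o by simp
  qed
qed

lemma blocks_no_layout: "\<not> local_queue_layout 2 {..18486} (apex_edges 18486 blocks) r P"
proof
  let ?E = "apex_edges 18486 blocks"
  assume L: "local_queue_layout 2 {..18486} ?E r P"
  have G: "simple_graph {..18486} ?E"
    using blocks_planar by (simp add: planar_graph_def)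
  interpret two_local "\<lambda>a b. {a, b} \<in> ?E" "\<lambda>v. int (card {w. (w, v) \<in> r})"
    "\<lambda>a b. THE Q. Q \<in> P \<and> {a, b} \<in> Q"
    by (rule local_queue_layout_two_local[OF G L])
  have apex: "{0, k} \<in> ?E" if "1 \<le> k" "k \<le> 18486" for k
    using that by (auto simp: apex_edges_def)
  have chord: "{i * 2054 + a, i * 2054 + b} \<in> ?E" if "i < 9" "(a, b) \<in> block" for i a b
    using that unfolding apex_edges_def blocks_def by blast
  have chord': "{i * 2054 + b, i * 2054 + a} \<in> ?E" if "i < 9" "(a, b) \<in> block" for i a b
    using chord[OF that] by (simp add: insert_commute)
  \<comment> \<open>The ends of the long chord of block \<open>i\<close>; these chords are the nine
    edges of \<open>no_nine_fanned_edges\<close>, with \<open>0\<close> as the apex.\<close>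
  define w where "w i b = i * 2054 + (if b then 2054 else 1)" for i :: nat and b
  have low: "fanned 0 (w i False)" if "i < 9" for i
  proof (rule fannedI[where I = "{..<513}" and x = "\<lambda>j. i * 2054 + (2 + 2 * j)"
      and x' = "\<lambda>j. i * 2054 + (3 + 2 * j)"])
    show "{0, w i False} \<in> ?E"
      using that by (intro apex) (auto simp: w_def)
    fix j :: nat assume j: "j \<in> {..<513}"
    show "{0, i * 2054 + (2 + 2 * j)} \<in> ?E" "{0, i * 2054 + (3 + 2 * j)} \<in> ?E"
      using that j by (auto intro!: apex)
    have "(1, 2 + 2 * j) \<in> block" "(1, 3 + 2 * j) \<in> block"
      using j by (auto simp: block_def)
    thus "{w i False, i * 2054 + (2 + 2 * j)} \<in> ?E" "{w i False, i * 2054 + (3 + 2 * j)} \<in> ?E"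
      by (simp_all only: w_def if_False chord[OF that])
    \<comment> \<open>The pairs of the lower half are those with index \<open>1 + j\<close> in
      \<open>block\<close>, and below those of the upper half have index
      \<open>514 + j\<close>.\<close>
    have "(2 + 2 * j, 3 + 2 * j) \<in> block"
      using j unfolding block_def by (intro UnI2 CollectI exI[of _ "1 + j"]) auto
    thus "{i * 2054 + (2 + 2 * j), i * 2054 + (3 + 2 * j)} \<in> ?E"
      by (rule chord[OF that])
    fix k :: nat assume "j \<noteq> k"
    hence "2 * j \<noteq> 2 * k" "2 * j \<noteq> Suc (2 * k)" "Suc (2 * j) \<noteq> 2 * k"
      by presburger+
    thus "{i * 2054 + (2 + 2 * j), i * 2054 + (3 + 2 * j)} \<inter> {i * 2054 + (2 + 2 * k), i * 2054 + (3 + 2 * k)} = {}"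
      by auto
  qed auto
  have high: "fanned 0 (w i True)" if "i < 9" for i
  proof (rule fannedI[where I = "{..<513}" and x = "\<lambda>j. i * 2054 + (1028 + 2 * j)"
      and x' = "\<lambda>j. i * 2054 + (1029 + 2 * j)"])
    show "{0, w i True} \<in> ?E"
      using that by (intro apex) (auto simp: w_def)
    fix j :: nat assume j: "j \<in> {..<513}"
    show "{0, i * 2054 + (1028 + 2 * j)} \<in> ?E" "{0, i * 2054 + (1029 + 2 * j)} \<in> ?E"
      using that j by (auto intro!: apex)
    have "(1028 + 2 * j, 2054) \<in> block" "(1029 + 2 * j, 2054) \<in> block"
      using j by (auto simp: block_def)
    thus "{w i True, i * 2054 + (1028 + 2 * j)} \<in> ?E" "{w i True, i * 2054 + (1029 + 2 * j)} \<in> ?E"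
      by (simp_all only: w_def if_True chord'[OF that])
    have "(1028 + 2 * j, 1029 + 2 * j) \<in> block"
      using j unfolding block_def by (intro UnI2 CollectI exI[of _ "514 + j"]) auto
    thus "{i * 2054 + (1028 + 2 * j), i * 2054 + (1029 + 2 * j)} \<in> ?E"
      by (rule chord[OF that])
    fix k :: nat assume "j \<noteq> k"
    hence "2 * j \<noteq> 2 * k" "2 * j \<noteq> Suc (2 * k)" "Suc (2 * j) \<noteq> 2 * k"
      by presburger+
    thus "{i * 2054 + (1028 + 2 * j), i * 2054 + (1029 + 2 * j)} \<inter> {i * 2054 + (1028 + 2 * k), i * 2054 + (1029 + 2 * k)} = {}"
      by auto
  qed auto
  show False
  proof (rule no_nine_fanned_edges[of 0 w])
    show "fanned 0 (w i b)" if "i < 9" for i b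
      using low[OF that] high[OF that] by (cases b) auto
    show "{w i False, w i True} \<in> ?E" if "i < 9" for i
      using chord[OF that, of 1 2054] by (simp add: w_def block_def)
    show "i = j \<and> b = c" if "w i b = w j c" for i j b c
    proof (rule linorder_cases[of i j])
      assume "i < j"
      thus ?thesis
        using that by (cases b; cases c) (simp_all add: w_def)
    next
      assume "j < i"
      thus ?thesis
        using that by (cases b; cases c) (simp_all add: w_def)
    next
      assume "i = j"
      thus ?thesis
        using that by (simp add: w_def split: if_splits)
    qed
  qed
qed

theorem corollary6:
  shows "(\<forall>(V :: 'a set) E. planar_graph V E \<longrightarrow> (\<exists>r P. local_queue_layout 4 V E r P)) \<and>
         (\<exists>(V :: nat set) E. planar_graph V E \<and> local_queue_number V E \<ge> 3)"
proof (intro conjI allI impI)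
  show "\<exists>r P. local_queue_layout 4 V E r P" if "planar_graph V E" for V :: "'a set" and E
    using that by (rule planar_local_queue_layout)
  let ?V = "{..18486::nat}" and ?E = "apex_edges 18486 blocks"
  have G: "simple_graph ?V ?E"
    using blocks_planar by (simp add: planar_graph_def)
  obtain r P where "local_queue_layout (local_queue_number ?V ?E) ?V ?E r P"
    using local_queue_number_attained[OF G] by blast
  \<comment> \<open>A layout attaining the minimum is 2-local as soon as the minimum is at most
    2.\<close>
  hence "local_queue_layout 2 ?V ?E r P" if "local_queue_number ?V ?E \<le> 2"
    using that by (auto simp: local_queue_layout_def intro: order_trans)
  hence "local_queue_number ?V ?E \<ge> 3"
    using blocks_no_layout[of r P] by fastforce
  thus "\<exists>(V :: nat set) E. planar_graph V E \<and> local_queue_number V E \<ge> 3"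
    using blocks_planar by blast
qed

end
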